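(* Suppose MR combining based on the LS estimator is used, i.e. $v_{m,k}=\hat h^{\mathrm{ls}}_{m,k}$ for all $m,k$. Fix a UE $k$ and a nonzero LSFD vector $\mathbf a_k=[\alpha_{1,k},\dots,\alpha_{M,k}]^T\in\mathbb C^M$, and put $\mathbf A_k=\mathrm{diag}(\alpha_{1,k},\dots,\alpha_{M,k})$. Then $\mathrm{SE}^{\mathrm{ul}}_k=\frac{\tau_u}{\tau_c}\log_2(1+\gamma^{\mathrm{ul,ls}}_k)$ with $$\gamma^{\mathrm{ul,ls}}_k=\frac{p_k|\mathrm{tr}(\mathbf A_k\mathbf R'_k)|^2}{\sum_{l=1}^K p_lT^{\mathrm{ls},(1)}_{k,l}+\sum_{l\in\mathcal P_k}p_lT^{\mathrm{ls},(2)}_{k,l}-p_k|\mathrm{tr}(\mathbf A_k\mathbf R'_k)|^2+\frac{\sigma^2_{\mathrm{ul}}}{\hat p_k\tau_p}\mathrm{tr}\big(\mathbf A_k^H(\boldsymbol\Lambda'_k)^{-1}\mathbf A_k\big)},$$ where $T^{\mathrm{ls},(1)}_{k,l}=\frac{1}{\hat p_k\tau_p}\mathrm{tr}(\mathbf A_k^H(\boldsymbol\Lambda'_k)^{-1}\mathbf R'_l\mathbf A_k)$ and $$T^{\mathrm{ls},(2)}_{k,l}=\frac{\hat p_l}{\hat p_k}\Big[\mathrm{tr}\big(\mathbf A_k^H(\mathbf R_l^2+2\mathbf L_l\mathbf R_l)\mathbf A_k\big)+|\mathrm{tr}(\mathbf A_k^H\mathbf R'_l)|^2-\mathrm{tr}\big(\mathbf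 A_k^H(\mathbf R'_l)^2\mathbf A_k\big)\Big].$$ Equivalently, in Rayleigh quotient form, $$\gamma^{\mathrm{ul,ls}}_k=\frac{p_k\,\mathbf a_k^H\mathbf b^{\mathrm{ls}}_k(\mathbf b^{\mathrm{ls}}_k)^H\mathbf a_k}{\mathbf a_k^H\boldsymbol\Gamma^{\mathrm{ls}}_k\mathbf a_k},\qquad \boldsymbol\Gamma^{\mathrm{ls}}_k=\sum_{l=1}^K p_l\boldsymbol\Gamma^{\mathrm{ls},(1)}_{k,l}+\sum_{l\in\mathcal P_k}p_l\boldsymbol\Gamma^{\mathrm{ls},(2)}_{k,l}-p_k\mathbf b^{\mathrm{ls}}_k(\mathbf b^{\mathrm{ls}}_k)^H+\frac{\sigma^2_{\mathrm{ul}}}{\hat p_k\tau_p}(\boldsymbol\Lambda'_k)^{-1},$$ where $\mathbf b^{\mathrm{ls}}_l=\mathrm{diag}(\mathbf R'_l)$, $\boldsymbol\Gamma^{\mathrm{ls},(1)}_{k,l}=\frac{1}{\hat p_k\tau_p}(\boldsymbol\Lambda'_k)^{-1}\mathbf R'_l$ and $\boldsymbol\Gamma^{\mathrm{ls},(2)}_{k,l}=\frac{\hat p_l}{\hat p_k}\big[\mathbf R_l^2+2\mathbf L_l\mathbf R_l+\mathbf b^{\mathrm{ls}}_l(\mathbf b^{\mathrm{ls}}_l)^H-(\mathbf R'_l)^2\big]$. The LSFD vector $\mathbf a_k=(\boldsymbol\Gamma^{\mathrm{ls}}_k)^{-1}\mathbf b^{\mathrm{ls}}_k$ maximizes $\mathrm{SE}^{\mathrm{ul}}_k$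 over $\mathbf a_k$, and with this vector $$\mathrm{SE}^{\mathrm{ul}}_k=\frac{\tau_u}{\tau_c}\log_2\left(1+p_k(\mathbf b^{\mathrm{ls}}_k)^H(\boldsymbol\Gamma^{\mathrm{ls}}_k)^{-1}\mathbf b^{\mathrm{ls}}_k\right).$$ Moreover this equals the uplink SE obtained with the LMMSE estimator and its maximizing LSFD vector, namely $\frac{\tau_u}{\tau_c}\log_2\left(1+p_k(\mathbf b^{\mathrm{lmmse}}_k)^H(\boldsymbol\Gamma^{\mathrm{lmmse}}_k)^{-1}\mathbf b^{\mathrm{lmmse}}_k\right)$, with $\mathbf b^{\mathrm{lmmse}}_k$ and $\boldsymbol\Gamma^{\mathrm{lmmse}}_k$ as defined in the context.
   Context: Channels. There are $M$ single-antenna access points (APs) and $K$ single-antenna users (UEs). The channel between AP $m$ and UE $k$ is $h_{m,k}=\bar h_{m,k}e^{j\varphi_{m,k}}+g_{m,k}$, with $\bar h_{m,k}\ge 0$ deterministic, $\varphi_{m,k}$ uniform on $[-\pi,\pi]$, $g_{m,k}\sim\mathcal N_{\mathbb C}(0,\beta_{m,k})$ (circularly symmetric complex Gaussian), $\beta_{m,k}>0$; all $\varphi_{m,k},g_{m,k}$ are mutually independent over $m,k$. Write $\mathbf h_k=[h_{1,k},\dots,h_{M,k}]^T$. Pilots. $\tau_c$ is the coherence block length, $\tau_p<K$ the pilot length, $\tau_u\le\tau_c-\tau_p$ the number of uplink data symbols. Each UE uses one of $\tau_p$ mutually orthogonal pilot sequences $\boldsymbol\phi_k\in\mathbb C^{\tau_p}$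 with $\|\boldsymbol\phi_k\|^2=\tau_p$, with pilot power $\hat p_k>0$. $\mathcal P_k$ is the set of UEs using the same pilot as UE $k$ (including $k$). After correlation with the pilot, AP $m$ has $$y^p_{m,k}=\sum_{l\in\mathcal P_k}\sqrt{\hat p_l}\,\tau_p h_{m,l}+\boldsymbol\phi_k^H\mathbf n^p_m,$$ where the $\mathbf n^p_m\sim\mathcal N_{\mathbb C}(\mathbf 0,\sigma^2_{\mathrm{ul}}\mathbf I_{\tau_p})$ are independent over $m$ and independent of all channels, and $\sigma^2_{\mathrm{ul}}>0$. Estimators. LS: $\hat h^{\mathrm{ls}}_{m,k}=\frac{1}{\sqrt{\hat p_k}\,\tau_p}y^p_{m,k}$. LMMSE: $\hat h^{\mathrm{lmmse}}_{m,k}=\sqrt{\hat p_k}\,\beta'_{m,k}y^p_{m,k}/\lambda'_{m,k}$. Here $\beta'_{m,k}=\beta_{m,k}+\bar h_{m,k}^2$ and $\lambda'_{m,k}=\sum_{l\in\mathcal P_k}\hat p_l\tau_p\beta'_{m,l}+\sigma^2_{\mathrm{ul}}$. Matrices (all $M\times M$ diagonal): $\mathbf R_k=\mathrm{diag}(\beta_{1,k},\dots,\beta_{M,k})$, $\mathbf L_k=\mathrm{diag}(\bar h_{1,k}^2,\dots,\bar h_{M,k}^2)$, $\mathbf R'_k=\mathbf R_k+\mathbf L_k$, $\boldsymbol\Lambda'_k=\mathrm{diag}(\lambda'_{1,k},\dots,\lambda'_{M,k})^{-1}$, $\boldsymbol\Omega'_k=\mathbf R'_k\boldsymbol\Lambda'_k\mathbf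 R'_k$. For a diagonal matrix $\mathbf D$, $\mathrm{diag}(\mathbf D)$ is the column vector of its diagonal entries. Uplink spectral efficiency. UE $k$ transmits data with power $p_k\ge 0$. With combining vector $\mathbf v_k=[v_{1,k},\dots,v_{M,k}]^T$ and deterministic LSFD (large-scale fading decoding) coefficients $\alpha_{m,k}\in\mathbb C$, the (use-and-then-forget) uplink SE of UE $k$ is defined as $\mathrm{SE}^{\mathrm{ul}}_k=\frac{\tau_u}{\tau_c}\log_2(1+\gamma^{\mathrm{ul}}_k)$ with $$\gamma^{\mathrm{ul}}_k=\frac{p_k|\mathbb E\{\mathbf v_k^H\mathbf A_k^H\mathbf h_k\}|^2}{\sum_{l=1}^K p_l\mathbb E\{|\mathbf v_k^H\mathbf A_k^H\mathbf h_l|^2\}-p_k|\mathbb E\{\mathbf v_k^H\mathbf A_k^H\mathbf h_k\}|^2+\sigma^2_{\mathrm{ul}}\mathbb E\{\|\mathbf A_k\mathbf v_k\|^2\}},$$ expectations being over all randomness. LMMSE quantities used for comparison (these describe the same SE when $v_{m,k}=\hat h^{\mathrm{lmmse}}_{m,k}$): $\mathbf b^{\mathrm{lmmse}}_k=\hat p_k\tau_p\mathrm{diag}(\boldsymbol\Omega'_k)$, $\mathbf d_{k,l}=\mathrm{diag}(\mathbf R'_l\boldsymbol\Lambda'_k\mathbf R'_k)$, and $$\boldsymbol\Gamma^{\mathrm{lmmse}}_k=\sum_{l=1}^K p_l\hat p_k\tau_p\mathbf R'_l\boldsymbol\Omega'_k+\sum_{l\in\mathcal P_k}p_l\hat p_k\hat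 p_l\tau_p^2\big[\mathbf R_l^2\boldsymbol\Lambda'_k\boldsymbol\Omega'_k+2\boldsymbol\Lambda'_k\boldsymbol\Omega'_k\mathbf L_l\mathbf R_l+\mathbf d_{k,l}\mathbf d_{k,l}^H-(\mathbf R'_l\boldsymbol\Lambda'_k\mathbf R'_k)^2\big]-p_k\mathbf b^{\mathrm{lmmse}}_k(\mathbf b^{\mathrm{lmmse}}_k)^H+\hat p_k\tau_p\sigma^2_{\mathrm{ul}}\boldsymbol\Omega'_k.$$ *)

theory Defs
  imports "HOL-Probability.Probability"
begin

section \<open>Hermitian linear algebra\<close>

text \<open>The library inner product on \<open>complex ^ 'n\<close> is the real one, so the Hermitian product
  \<open>u\<^sup>H v\<close>, the outer product \<open>u v\<^sup>H\<close> and the conjugate transpose are introduced here.\<close>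

definition hdot :: "complex ^ 'n \<Rightarrow> complex ^ 'n \<Rightarrow> complex" where
  "hdot u v = (\<Sum>i\<in>UNIV. cnj (u $ i) * v $ i)"

definition houter :: "complex ^ 'm \<Rightarrow> complex ^ 'n \<Rightarrow> complex ^ 'n ^ 'm" where
  "houter u v = (\<chi> i j. u $ i * cnj (v $ j))"

definition hadj :: "complex ^ 'n ^ 'm \<Rightarrow> complex ^ 'm ^ 'n" where
  "hadj A = (\<chi> i j. cnj (A $ j $ i))"

definition diag_mat :: "complex ^ 'n \<Rightarrow> complex ^ 'n ^ 'n" where
  "diag_mat d = (\<chi> i j. if i = j then d $ i else 0)"

definition diag_vec :: "complex ^ 'n ^ 'n \<Rightarrow> complex ^ 'n" where
  "diag_vec D = (\<chi> i. D $ i $ i)"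

section \<open>Circularly symmetric complex Gaussian variables\<close>

definition cscg :: "'w measure \<Rightarrow> ('w \<Rightarrow> complex) \<Rightarrow> real \<Rightarrow> bool" where
  "cscg M X v \<longleftrightarrow>
     prob_space.indep_var M borel (\<lambda>\<omega>. Re (X \<omega>)) borel (\<lambda>\<omega>. Im (X \<omega>)) \<and>
     distributed M lborel (\<lambda>\<omega>. Re (X \<omega>)) (normal_density 0 (sqrt (v / 2))) \<and>
     distributed M lborel (\<lambda>\<omega>. Im (X \<omega>)) (normal_density 0 (sqrt (v / 2)))"

text \<open>A random vector with law \<open>N\<^sub>C(0, v I)\<close>.\<close>

definition cscg_vec :: "'w measure \<Rightarrow> ('w \<Rightarrow> complex ^ 'n) \<Rightarrow> real \<Rightarrow> bool" where
  "cscg_vec M X v \<longleftrightarrow>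
     prob_space.indep_vars M (\<lambda>_. borel) (\<lambda>i \<omega>. X \<omega> $ i) UNIV \<and>
     (\<forall>i. cscg M (\<lambda>\<omega>. X \<omega> $ i) v)"

section \<open>The cell-free system\<close>

text \<open>The types \<open>'m\<close>, \<open>'k\<close> and \<open>'t\<close> index the access points, the users and the \<open>\<tau>\<^sub>p\<close> pilot
  sequences of length \<open>\<tau>\<^sub>p\<close>; thus \<open>M\<close>, \<open>K\<close> and \<open>\<tau>\<^sub>p\<close> are the cardinalities of these types.
  User \<open>k\<close> transmits the sequence \<open>pilot_seq S (pilot_of S k)\<close>.\<close>

record ('w, 'm, 'k, 't::finite) cf_system =
  pspace :: "'w measure"
  hbar :: "'m \<Rightarrow> 'k \<Rightarrow> real"
  beta :: "'m \<Rightarrow> 'k \<Rightarrow> real"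
  phase :: "'m \<Rightarrow> 'k \<Rightarrow> 'w \<Rightarrow> real"
  scatter :: "'m \<Rightarrow> 'k \<Rightarrow> 'w \<Rightarrow> complex"
  noise :: "'m \<Rightarrow> 'w \<Rightarrow> complex ^ 't"
  pilot_seq :: "'t \<Rightarrow> complex ^ 't"
  pilot_of :: "'k \<Rightarrow> 't"
  pilot_pow :: "'k \<Rightarrow> real"
  data_pow :: "'k \<Rightarrow> real"
  sigma2 :: real
  tau_c :: nat
  tau_u :: nat

definition tau_p :: "('w, 'm, 'k, 't::finite) cf_system \<Rightarrow> nat" where
  "tau_p S = CARD('t)"

datatype ('m, 'k) source = Phase 'm 'k | Scatter 'm 'k | Noise 'm

text \<open>The sigma-algebra generated by each elementary source of randomness. Independence is
  expressed on sigma-algebras because the sources take values in different types.\<close>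

fun source_events ::
    "('w, 'm, 'k, 't::finite) cf_system \<Rightarrow> ('m, 'k) source \<Rightarrow> 'w set set" where
  "source_events S (Phase m k) = sets (vimage_algebra (space (pspace S)) (phase S m k) borel)"
| "source_events S (Scatter m k) = sets (vimage_algebra (space (pspace S)) (scatter S m k) borel)"
| "source_events S (Noise m) = sets (vimage_algebra (space (pspace S)) (noise S m) borel)"

locale cell_free = prob_space "pspace S"
  for S :: "('w, 'm::finite, 'k::finite, 't::finite) cf_system" +
  assumes hbar_nonneg: "0 \<le> hbar S m k"
    and beta_pos: "0 < beta S m k"
    and phase_uniform: "distributed (pspace S) lborel (phase S m k)
          (\<lambda>x. indicator {-pi..pi} x / measure lborel {-pi..pi})"
    and scatter_gaussian: "cscg (pspace S) (scatter S m k) (beta S m k)"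
    and noise_gaussian: "cscg_vec (pspace S) (noise S m) (sigma2 S)"
    and sources_indep: "indep_sets (source_events S) UNIV"
    and pilots_orthogonal: "s \<noteq> t \<Longrightarrow> hdot (pilot_seq S s) (pilot_seq S t) = 0"
    and pilots_norm: "(norm (pilot_seq S t))\<^sup>2 = real (tau_p S)"
    and pilot_pow_pos: "0 < pilot_pow S k"
    and data_pow_nonneg: "0 \<le> data_pow S k"
    and sigma2_pos: "0 < sigma2 S"
    and tau_p_less: "tau_p S < CARD('k)"
    and tau_u_le: "tau_u S + tau_p S \<le> tau_c S"

definition copilot :: "('w, 'm, 'k, 't::finite) cf_system \<Rightarrow> 'k \<Rightarrow> 'k set" where
  "copilot S k = {l. pilot_of S l = pilot_of S k}"

definition chan ::
    "('w, 'm::finite, 'k, 't::finite) cf_system \<Rightarrow> 'k \<Rightarrow> 'w \<Rightarrow> complex ^ 'm" where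
  "chan S k \<omega> =
     (\<chi> m. complex_of_real (hbar S m k) * cis (phase S m k \<omega>) + scatter S m k \<omega>)"

definition pilot_obs ::
    "('w, 'm::finite, 'k, 't::finite) cf_system \<Rightarrow> 'k \<Rightarrow> 'w \<Rightarrow> complex ^ 'm" where
  "pilot_obs S k \<omega> =
     (\<chi> m. (\<Sum>l\<in>copilot S k.
              complex_of_real (sqrt (pilot_pow S l) * real (tau_p S)) * chan S l \<omega> $ m)
          + hdot (pilot_seq S (pilot_of S k)) (noise S m \<omega>))"

definition beta' :: "('w, 'm, 'k, 't::finite) cf_system \<Rightarrow> 'm \<Rightarrow> 'k \<Rightarrow> real" where
  "beta' S m k = beta S m k + (hbar S m k)\<^sup>2"

definition lambda' :: "('w, 'm, 'k, 't::finite) cf_system \<Rightarrow> 'm \<Rightarrow> 'k \<Rightarrow> real" where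
  "lambda' S m k =
     (\<Sum>l\<in>copilot S k. pilot_pow S l * real (tau_p S) * beta' S m l) + sigma2 S"

definition est_ls ::
    "('w, 'm::finite, 'k, 't::finite) cf_system \<Rightarrow> 'k \<Rightarrow> 'w \<Rightarrow> complex ^ 'm" where
  "est_ls S k \<omega> =
     (\<chi> m. complex_of_real (1 / (sqrt (pilot_pow S k) * real (tau_p S))) * pilot_obs S k \<omega> $ m)"

definition est_lmmse ::
    "('w, 'm::finite, 'k, 't::finite) cf_system \<Rightarrow> 'k \<Rightarrow> 'w \<Rightarrow> complex ^ 'm" where
  "est_lmmse S k \<omega> =
     (\<chi> m. complex_of_real (sqrt (pilot_pow S k) * beta' S m k / lambda' S m k)
           * pilot_obs S k \<omega> $ m)"

section \<open>Use-and-then-forget uplink spectral efficiency\<close>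

text \<open>The arguments \<open>v\<close> and \<open>a\<close> are the random combining vector and the LSFD vector of user \<open>k\<close>;
  \<open>comb S v a l\<close> is \<open>v\<^sub>k\<^sup>H A\<^sub>k\<^sup>H h\<^sub>l\<close>.\<close>

definition comb ::
    "('w, 'm::finite, 'k, 't::finite) cf_system \<Rightarrow> ('w \<Rightarrow> complex ^ 'm) \<Rightarrow> complex ^ 'm
      \<Rightarrow> 'k \<Rightarrow> 'w \<Rightarrow> complex" where
  "comb S v a l \<omega> = hdot (v \<omega>) (hadj (diag_mat a) *v chan S l \<omega>)"

definition sinr_ul ::
    "('w, 'm::finite, 'k::finite, 't::finite) cf_system \<Rightarrow> ('w \<Rightarrow> complex ^ 'm) \<Rightarrow> 'k
      \<Rightarrow> complex ^ 'm \<Rightarrow> real" where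
  "sinr_ul S v k a =
     data_pow S k * (cmod (integral\<^sup>L (pspace S) (comb S v a k)))\<^sup>2 /
     ((\<Sum>l\<in>UNIV. data_pow S l * integral\<^sup>L (pspace S) (\<lambda>\<omega>. (cmod (comb S v a l \<omega>))\<^sup>2))
      - data_pow S k * (cmod (integral\<^sup>L (pspace S) (comb S v a k)))\<^sup>2
      + sigma2 S * integral\<^sup>L (pspace S) (\<lambda>\<omega>. (norm (diag_mat a *v v \<omega>))\<^sup>2))"

definition rate :: "('w, 'm, 'k, 't::finite) cf_system \<Rightarrow> real \<Rightarrow> real" where
  "rate S g = real (tau_u S) / real (tau_c S) * log 2 (1 + g)"

definition SE_ul ::
    "('w, 'm::finite, 'k::finite, 't::finite) cf_system \<Rightarrow> ('w \<Rightarrow> complex ^ 'm) \<Rightarrow> 'k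
      \<Rightarrow> complex ^ 'm \<Rightarrow> real" where
  "SE_ul S v k a = rate S (sinr_ul S v k a)"

section \<open>Deterministic matrices\<close>

definition Rm :: "('w, 'm::finite, 'k, 't::finite) cf_system \<Rightarrow> 'k \<Rightarrow> complex ^ 'm ^ 'm" where
  "Rm S k = diag_mat (\<chi> m. complex_of_real (beta S m k))"

definition Lm :: "('w, 'm::finite, 'k, 't::finite) cf_system \<Rightarrow> 'k \<Rightarrow> complex ^ 'm ^ 'm" where
  "Lm S k = diag_mat (\<chi> m. complex_of_real ((hbar S m k)\<^sup>2))"

definition Rm' :: "('w, 'm::finite, 'k, 't::finite) cf_system \<Rightarrow> 'k \<Rightarrow> complex ^ 'm ^ 'm" where
  "Rm' S k = Rm S k + Lm S k"

definition Lam' :: "('w, 'm::finite, 'k, 't::finite) cf_system \<Rightarrow> 'k \<Rightarrow> complex ^ 'm ^ 'm" where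
  "Lam' S k = matrix_inv (diag_mat (\<chi> m. complex_of_real (lambda' S m k)))"

definition Om' :: "('w, 'm::finite, 'k, 't::finite) cf_system \<Rightarrow> 'k \<Rightarrow> complex ^ 'm ^ 'm" where
  "Om' S k = Rm' S k ** Lam' S k ** Rm' S k"

section \<open>LS quantities\<close>

definition T_ls1 ::
    "('w, 'm::finite, 'k, 't::finite) cf_system \<Rightarrow> 'k \<Rightarrow> 'k \<Rightarrow> complex ^ 'm \<Rightarrow> complex" where
  "T_ls1 S k l a =
     complex_of_real (1 / (pilot_pow S k * real (tau_p S)))
     * trace (hadj (diag_mat a) ** matrix_inv (Lam' S k) ** Rm' S l ** diag_mat a)"

definition T_ls2 ::
    "('w, 'm::finite, 'k, 't::finite) cf_system \<Rightarrow> 'k \<Rightarrow> 'k \<Rightarrow> complex ^ 'm \<Rightarrow> complex" where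
  "T_ls2 S k l a =
     complex_of_real (pilot_pow S l / pilot_pow S k)
     * (trace (hadj (diag_mat a) ** (Rm S l ** Rm S l + 2 *\<^sub>R (Lm S l ** Rm S l)) ** diag_mat a)
        + complex_of_real ((cmod (trace (hadj (diag_mat a) ** Rm' S l)))\<^sup>2)
        - trace (hadj (diag_mat a) ** (Rm' S l ** Rm' S l) ** diag_mat a))"

text \<open>Quantities that are built from complex traces and quadratic forms are kept complex; that
  they are real is part of what has to be shown.\<close>

definition den_ls ::
    "('w, 'm::finite, 'k::finite, 't::finite) cf_system \<Rightarrow> 'k \<Rightarrow> complex ^ 'm \<Rightarrow> complex" where
  "den_ls S k a =
     (\<Sum>l\<in>UNIV. complex_of_real (data_pow S l) * T_ls1 S k l a)
     + (\<Sum>l\<in>copilot S k. complex_of_real (data_pow S l) * T_ls2 S k l a)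
     - complex_of_real (data_pow S k * (cmod (trace (diag_mat a ** Rm' S k)))\<^sup>2)
     + complex_of_real (sigma2 S / (pilot_pow S k * real (tau_p S)))
       * trace (hadj (diag_mat a) ** matrix_inv (Lam' S k) ** diag_mat a)"

definition gamma_ls ::
    "('w, 'm::finite, 'k::finite, 't::finite) cf_system \<Rightarrow> 'k \<Rightarrow> complex ^ 'm \<Rightarrow> complex" where
  "gamma_ls S k a =
     complex_of_real (data_pow S k * (cmod (trace (diag_mat a ** Rm' S k)))\<^sup>2) / den_ls S k a"

definition b_ls :: "('w, 'm::finite, 'k, 't::finite) cf_system \<Rightarrow> 'k \<Rightarrow> complex ^ 'm" where
  "b_ls S l = diag_vec (Rm' S l)"

definition Gam_ls1 ::
    "('w, 'm::finite, 'k, 't::finite) cf_system \<Rightarrow> 'k \<Rightarrow> 'k \<Rightarrow> complex ^ 'm ^ 'm" where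
  "Gam_ls1 S k l =
     (1 / (pilot_pow S k * real (tau_p S))) *\<^sub>R (matrix_inv (Lam' S k) ** Rm' S l)"

definition Gam_ls2 ::
    "('w, 'm::finite, 'k, 't::finite) cf_system \<Rightarrow> 'k \<Rightarrow> 'k \<Rightarrow> complex ^ 'm ^ 'm" where
  "Gam_ls2 S k l =
     (pilot_pow S l / pilot_pow S k) *\<^sub>R
     (Rm S l ** Rm S l + 2 *\<^sub>R (Lm S l ** Rm S l)
      + houter (b_ls S l) (b_ls S l) - Rm' S l ** Rm' S l)"

definition Gam_ls ::
    "('w, 'm::finite, 'k::finite, 't::finite) cf_system \<Rightarrow> 'k \<Rightarrow> complex ^ 'm ^ 'm" where
  "Gam_ls S k =
     (\<Sum>l\<in>UNIV. data_pow S l *\<^sub>R Gam_ls1 S k l)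
     + (\<Sum>l\<in>copilot S k. data_pow S l *\<^sub>R Gam_ls2 S k l)
     - data_pow S k *\<^sub>R houter (b_ls S k) (b_ls S k)
     + (sigma2 S / (pilot_pow S k * real (tau_p S))) *\<^sub>R matrix_inv (Lam' S k)"

section \<open>LMMSE quantities\<close>

definition b_lmmse :: "('w, 'm::finite, 'k, 't::finite) cf_system \<Rightarrow> 'k \<Rightarrow> complex ^ 'm" where
  "b_lmmse S k = (pilot_pow S k * real (tau_p S)) *\<^sub>R diag_vec (Om' S k)"

definition d_vec :: "('w, 'm::finite, 'k, 't::finite) cf_system \<Rightarrow> 'k \<Rightarrow> 'k \<Rightarrow> complex ^ 'm" where
  "d_vec S k l = diag_vec (Rm' S l ** Lam' S k ** Rm' S k)"

definition Gam_lmmse ::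
    "('w, 'm::finite, 'k::finite, 't::finite) cf_system \<Rightarrow> 'k \<Rightarrow> complex ^ 'm ^ 'm" where
  "Gam_lmmse S k =
     (\<Sum>l\<in>UNIV. (data_pow S l * pilot_pow S k * real (tau_p S)) *\<^sub>R (Rm' S l ** Om' S k))
     + (\<Sum>l\<in>copilot S k.
          (data_pow S l * pilot_pow S k * pilot_pow S l * (real (tau_p S))\<^sup>2) *\<^sub>R
          (Rm S l ** Rm S l ** Lam' S k ** Om' S k
           + 2 *\<^sub>R (Lam' S k ** Om' S k ** Lm S l ** Rm S l)
           + houter (d_vec S k l) (d_vec S k l)
           - (Rm' S l ** Lam' S k ** Rm' S k) ** (Rm' S l ** Lam' S k ** Rm' S k)))
     - data_pow S k *\<^sub>R houter (b_lmmse S k) (b_lmmse S k)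
     + (pilot_pow S k * real (tau_p S) * sigma2 S) *\<^sub>R Om' S k"

end

theory Submission
  imports Defs
begin

text \<open>With \<open>v\<^sub>m = w\<^sub>m y\<^sub>m\<close> for real weights \<open>w\<^sub>m\<close>, both estimators are rescaled pilot observations.
  Write \<open>y\<^sub>m = c\<^sub>l h\<^sub>m\<^sub>l + z\<close>, where \<open>c\<^sub>l = 0\<close> unless user \<open>l\<close> shares the pilot, and where \<open>z\<close> is centred and
  independent of \<open>h\<^sub>m\<^sub>l\<close>. The second and fourth moments of the Rician channels then give every expectation
  in the SINR, which becomes a Rayleigh quotient with gain vector \<open>D b\<close> and positive definite matrix
  \<open>D \<Gamma> D\<close>, where \<open>D = diag w\<close>. Its maximum \<open>p\<^sub>k b\<^sup>H \<Gamma>\<^sup>-\<^sup>1 b\<close> is attained at \<open>D\<^sup>-\<^sup>1 \<Gamma>\<^sup>-\<^sup>1 b\<close> and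
  does not depend on \<open>w\<close>, so LS and LMMSE have the same optimal value.\<close>

section \<open>Moments of independent complex variables\<close>

text \<open>Across APs the products \<open>cnj y_m * h_ml\<close> are independent but not centred
  when the pilot is shared. The second moment of their weighted sum is therefore the squared modulus
  of the total mean, which is the rank-one part of the Gamma matrix, plus one variance per AP, which
  is the diagonal part. The constant modulus of the line-of-sight term makes
  \<open>E |h|^4 = 2 beta'^2 - hbar^4\<close> instead of the Gaussian value
  \<open>2 beta'^2\<close>, so the diagonal correction \<open>R^2 + 2 L R - R'^2\<close> is just
  \<open>- L^2\<close>. Since this is nonpositive, positive definiteness is not immediate: the
  correction is paid for by the contribution of user \<open>l\<close> to \<open>lambda'\<close>, and
  strictness comes from the noise. Expectations are carried as \<open>has_bochner_integral\<close>
  facts, which pair integrability with the value, and squared moduli as \<open>X * cnj X\<close>, so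
  that computing a moment reduces to a polynomial identity in variables and their
  conjugates.\<close>

lemma has_bochner_integral_complex_of_real:
  fixes f :: "'a \<Rightarrow> real"
  assumes "has_bochner_integral M f x"
  shows "has_bochner_integral M (\<lambda>\<omega>. complex_of_real (f \<omega>)) (complex_of_real x)"
  using has_bochner_integral_bounded_linear[OF bounded_linear_of_real assms] .

lemma has_bochner_integral_Re:
  assumes "has_bochner_integral M f x"
  shows "has_bochner_integral M (\<lambda>\<omega>. Re (f \<omega>)) (Re x)"
  using has_bochner_integral_bounded_linear[OF bounded_linear_Re assms] .

lemma has_bochner_integral_cnj:
  assumes "has_bochner_integral M f x"
  shows "has_bochner_integral M (\<lambda>\<omega>. cnj (f \<omega>)) (cnj x)"
  using has_bochner_integral_bounded_linear[OF bounded_linear_cnj assms] .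

text \<open>The pattern of the moment computations: a linear combination of known moments is the
  first premise, which leaves two algebraic identities, one for the integrand and one for the
  value.\<close>

lemma has_bochner_integral_eqI:
  assumes "has_bochner_integral M f x" "\<And>\<omega>. g \<omega> = f \<omega>" "y = x"
  shows "has_bochner_integral M g y"
proof -
  have "g = f" using assms(2) by auto
  with assms show ?thesis by simp
qed

lemma borel_measurable_cnj_id [measurable, simp]: "cnj \<in> borel_measurable borel"
  by (intro borel_measurable_continuous_onI continuous_intros)

text \<open>Domination of \<open>|X Y|\<close> by \<open>|X|^2 + |Y|^2\<close>. It supplies the
  third moment of a channel, whose value is never computed.\<close>

lemma integrable_mult_of_square_integrable:
  fixes X Y :: "'a \<Rightarrow> complex"
  assumes [measurable]: "X \<in> borel_measurable M" "Y \<in> borel_measurable M"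
    and "integrable M (\<lambda>\<omega>. X \<omega> * cnj (X \<omega>))" "integrable M (\<lambda>\<omega>. Y \<omega> * cnj (Y \<omega>))"
  shows "integrable M (\<lambda>\<omega>. X \<omega> * Y \<omega>)"
proof (rule Bochner_Integration.integrable_bound)
  show "integrable M (\<lambda>\<omega>. X \<omega> * cnj (X \<omega>) + Y \<omega> * cnj (Y \<omega>))"
    using assms by auto
  show "AE \<omega> in M. norm (X \<omega> * Y \<omega>) \<le> norm (X \<omega> * cnj (X \<omega>) + Y \<omega> * cnj (Y \<omega>))"
  proof (rule AE_I2)
    fix \<omega>
    have "2 * (cmod (X \<omega>) * cmod (Y \<omega>)) \<le> (cmod (X \<omega>))\<^sup>2 + (cmod (Y \<omega>))\<^sup>2"
      using sum_squares_bound[of "cmod (X \<omega>)" "cmod (Y \<omega>)"] by simp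
    moreover have "0 \<le> cmod (X \<omega>) * cmod (Y \<omega>)" by simp
    moreover have "norm (X \<omega> * cnj (X \<omega>) + Y \<omega> * cnj (Y \<omega>)) = (cmod (X \<omega>))\<^sup>2 + (cmod (Y \<omega>))\<^sup>2"
      unfolding complex_norm_square[symmetric] of_real_add[symmetric] norm_of_real by simp
    ultimately show "norm (X \<omega> * Y \<omega>) \<le> norm (X \<omega> * cnj (X \<omega>) + Y \<omega> * cnj (Y \<omega>))"
      unfolding norm_mult by linarith
  qed
qed simp

section \<open>Independence of grouped variables and second moments of sums\<close>

context prob_space
begin

text \<open>Keeping \<open>f\<close> and \<open>g\<close> apart from \<open>X\<close> and
  \<open>Y\<close> lets a single independence fact yield every mixed moment.\<close>

lemma has_bochner_integral_indep_mult:
  fixes f g :: "complex \<Rightarrow> complex"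
  assumes "indep_var borel X borel Y"
    and [measurable]: "f \<in> borel_measurable borel" "g \<in> borel_measurable borel"
    and f: "has_bochner_integral M (\<lambda>\<omega>. f (X \<omega>)) a"
    and g: "has_bochner_integral M (\<lambda>\<omega>. g (Y \<omega>)) b"
  shows "has_bochner_integral M (\<lambda>\<omega>. f (X \<omega>) * g (Y \<omega>)) (a * b)"
proof -
  have "indep_var borel (f \<circ> X) borel (g \<circ> Y)"
    using assms(1) by (rule indep_var_compose) auto
  then have i: "indep_var borel (\<lambda>\<omega>. f (X \<omega>)) borel (\<lambda>\<omega>. g (Y \<omega>))"
    by (simp add: comp_def)
  show ?thesis
    using indep_var_lebesgue_integral[OF i] indep_var_integrable[OF i] f g
    by (simp add: has_bochner_integral_iff)
qed

text \<open>Writing \<open>W j\<close> as \<open>F j\<close> of the restriction to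
  \<open>K j\<close> certifies that it sees its own block only. The blocks are first the phase and
  the scatter term of one channel, later all links of one AP.\<close>

lemma indep_vars_group:
  assumes "indep_vars (\<lambda>_. borel) X UNIV"
    and "disjoint_family_on K L"
    and F: "\<And>j. j \<in> L \<Longrightarrow> F j \<in> borel_measurable (PiM (K j) (\<lambda>_. borel))"
    and W: "\<And>j \<omega>. j \<in> L \<Longrightarrow> W j \<omega> = F j (restrict (\<lambda>i. X i \<omega>) (K j))"
  shows "indep_vars (\<lambda>_. borel) W L"
proof -
  have "indep_vars (\<lambda>j. PiM (K j) (\<lambda>_. borel)) (\<lambda>j \<omega>. restrict (\<lambda>i. X i \<omega>) (K j)) L"
    by (rule indep_vars_restrict[OF assms(1)]) (use assms(2) in auto)
  then have "indep_vars (\<lambda>_. borel) (\<lambda>j \<omega>. F j (restrict (\<lambda>i. X i \<omega>) (K j))) L"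
    by (rule indep_vars_compose2) (use F in auto)
  then show ?thesis
    by (rule indep_vars_cong[THEN iffD1, rotated -1]) (use W in auto)
qed

lemma indep_var_group:
  assumes "indep_vars (\<lambda>_. borel) X UNIV"
    and "A \<inter> B = {}"
    and F: "F \<in> borel_measurable (PiM A (\<lambda>_. borel))" "\<And>\<omega>. U \<omega> = F (restrict (\<lambda>i. X i \<omega>) A)"
    and G: "G \<in> borel_measurable (PiM B (\<lambda>_. borel))" "\<And>\<omega>. V \<omega> = G (restrict (\<lambda>i. X i \<omega>) B)"
  shows "indep_var borel U borel V"
proof -
  have "indep_var (PiM A (\<lambda>_. borel)) (\<lambda>\<omega>. restrict (\<lambda>i. X i \<omega>) A)
      (PiM B (\<lambda>_. borel)) (\<lambda>\<omega>. restrict (\<lambda>i. X i \<omega>) B)"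
    by (rule indep_var_restrict[OF assms(1)]) (use assms(2) in auto)
  then have "indep_var borel (F \<circ> (\<lambda>\<omega>. restrict (\<lambda>i. X i \<omega>) A)) borel (G \<circ> (\<lambda>\<omega>. restrict (\<lambda>i. X i \<omega>) B))"
    by (rule indep_var_compose) (use F G in auto)
  moreover have "F \<circ> (\<lambda>\<omega>. restrict (\<lambda>i. X i \<omega>) A) = U" "G \<circ> (\<lambda>\<omega>. restrict (\<lambda>i. X i \<omega>) B) = V"
    using F(2) G(2) by auto
  ultimately show ?thesis by simp
qed

lemma indep_vars_pair:
  fixes X :: "'i \<Rightarrow> 'a \<Rightarrow> 'b::topological_space"
  assumes "indep_vars (\<lambda>_. borel) X UNIV" "i \<noteq> j"
  shows "indep_var borel (X i) borel (X j)"
  by (rule indep_var_group[OF assms(1), of "{i}" "{j}" "\<lambda>f. f i" _ "\<lambda>f. f j"])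
     (use assms(2) in auto)

text \<open>Off-diagonal products factor into \<open>\<mu> i * cnj (\<mu> j)\<close>. Using these
  values on the diagonal as well completes the double sum to the squared modulus of the total mean,
  at the price of the correction \<open>t i - |\<mu> i|^2\<close>.\<close>

lemma second_moment_sum_indep:
  fixes X :: "'i::finite \<Rightarrow> 'a \<Rightarrow> complex" and t :: "'i \<Rightarrow> real"
  assumes ind: "indep_vars (\<lambda>_. borel) X UNIV"
    and m: "\<And>i. has_bochner_integral M (X i) (\<mu> i)"
    and v: "\<And>i. has_bochner_integral M (\<lambda>\<omega>. X i \<omega> * cnj (X i \<omega>)) (of_real (t i))"
  shows "has_bochner_integral M (\<lambda>\<omega>. (\<Sum>i\<in>UNIV. X i \<omega>) * cnj (\<Sum>i\<in>UNIV. X i \<omega>))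
    (of_real ((cmod (\<Sum>i\<in>UNIV. \<mu> i))\<^sup>2 - (\<Sum>i\<in>UNIV. (cmod (\<mu> i))\<^sup>2) + (\<Sum>i\<in>UNIV. t i)))"
proof -
  have *: "has_bochner_integral M (\<lambda>\<omega>. X i \<omega> * cnj (X j \<omega>))
      (\<mu> i * cnj (\<mu> j) + (if i = j then of_real (t i) - \<mu> i * cnj (\<mu> j) else 0))" for i j
  proof (cases "i = j")
    case False
    have "has_bochner_integral M (\<lambda>\<omega>. X i \<omega> * cnj (X j \<omega>)) (\<mu> i * cnj (\<mu> j))"
      by (rule has_bochner_integral_indep_mult[OF indep_vars_pair[OF ind False], where f="\<lambda>x. x"])
         (auto intro!: m has_bochner_integral_cnj)
    with False show ?thesis by simp
  qed (use v in simp)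
  have "has_bochner_integral M (\<lambda>\<omega>. \<Sum>i\<in>UNIV. \<Sum>j\<in>UNIV. X i \<omega> * cnj (X j \<omega>))
     (\<Sum>i\<in>UNIV. \<Sum>j\<in>UNIV. \<mu> i * cnj (\<mu> j) + (if i = j then of_real (t i) - \<mu> i * cnj (\<mu> j) else 0))"
    by (intro has_bochner_integral_sum *)
  then show ?thesis
  proof (rule has_bochner_integral_eqI)
    show "(\<Sum>i\<in>UNIV. X i \<omega>) * cnj (\<Sum>i\<in>UNIV. X i \<omega>)
      = (\<Sum>i\<in>UNIV. \<Sum>j\<in>UNIV. X i \<omega> * cnj (X j \<omega>))" for \<omega>
      by (simp add: sum_product)
    have "(\<Sum>i\<in>UNIV. \<Sum>j\<in>UNIV. \<mu> i * cnj (\<mu> j) + (if i = j then of_real (t i) - \<mu> i * cnj (\<mu> j) else 0))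
      = (\<Sum>i\<in>UNIV. \<mu> i) * cnj (\<Sum>i\<in>UNIV. \<mu> i) + (\<Sum>i\<in>UNIV. of_real (t i) - \<mu> i * cnj (\<mu> i))"
      by (simp add: sum.distrib sum_product)
    also have "\<dots> = of_real ((cmod (\<Sum>i\<in>UNIV. \<mu> i))\<^sup>2 - (\<Sum>i\<in>UNIV. (cmod (\<mu> i))\<^sup>2) + (\<Sum>i\<in>UNIV. t i))"
      by (simp add: complex_norm_square[symmetric] sum_subtractf del: cnj_sum)
    finally show "of_real ((cmod (\<Sum>i\<in>UNIV. \<mu> i))\<^sup>2 - (\<Sum>i\<in>UNIV. (cmod (\<mu> i))\<^sup>2) + (\<Sum>i\<in>UNIV. t i))
      = (\<Sum>i\<in>UNIV. \<Sum>j\<in>UNIV. \<mu> i * cnj (\<mu> j) + (if i = j then of_real (t i) - \<mu> i * cnj (\<mu> j) else 0))"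
      by simp
  qed
qed

text \<open>Zero means remove the mean terms of \<open>second_moment_sum_indep\<close>, so only
  weighted variances remain. Serves the despread noise, over the coordinates of a noise vector, and
  the interference, over the summands of the pilot observation.\<close>

lemma centered_linear_combination:
  fixes X :: "'i::finite \<Rightarrow> 'a \<Rightarrow> complex" and v :: "'i \<Rightarrow> real" and c :: "'i \<Rightarrow> complex"
  assumes ind: "indep_vars (\<lambda>_. borel) X UNIV"
    and m: "\<And>i. has_bochner_integral M (X i) 0"
    and v: "\<And>i. has_bochner_integral M (\<lambda>\<omega>. X i \<omega> * cnj (X i \<omega>)) (of_real (v i))"
  shows "has_bochner_integral M (\<lambda>\<omega>. \<Sum>i\<in>UNIV. c i * X i \<omega>) 0"
    and "has_bochner_integral M (\<lambda>\<omega>. (\<Sum>i\<in>UNIV. c i * X i \<omega>) * cnj (\<Sum>i\<in>UNIV. c i * X i \<omega>))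
      (of_real (\<Sum>i\<in>UNIV. (cmod (c i))\<^sup>2 * v i))"
proof -
  have ind': "indep_vars (\<lambda>_. borel) (\<lambda>i \<omega>. c i * X i \<omega>) UNIV"
    by (rule indep_vars_compose2[OF ind]) auto
  have m': "has_bochner_integral M (\<lambda>\<omega>. c i * X i \<omega>) 0" for i
    using has_bochner_integral_mult_right[OF m, of "c i"] by simp
  have v': "has_bochner_integral M (\<lambda>\<omega>. (c i * X i \<omega>) * cnj (c i * X i \<omega>)) (of_real ((cmod (c i))\<^sup>2 * v i))" for i
    by (rule has_bochner_integral_eqI[OF has_bochner_integral_mult_right[OF v, of "c i * cnj (c i)"]])
       (simp_all only: of_real_mult complex_norm_square complex_cnj_mult mult_ac)
  show "has_bochner_integral M (\<lambda>\<omega>. \<Sum>i\<in>UNIV. c i * X i \<omega>) 0"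
    using has_bochner_integral_sum[of UNIV M "\<lambda>i \<omega>. c i * X i \<omega>" "\<lambda>_. 0"] m' by simp
  show "has_bochner_integral M (\<lambda>\<omega>. (\<Sum>i\<in>UNIV. c i * X i \<omega>) * cnj (\<Sum>i\<in>UNIV. c i * X i \<omega>))
      (of_real (\<Sum>i\<in>UNIV. (cmod (c i))\<^sup>2 * v i))"
    using second_moment_sum_indep[OF ind' m' v'] by simp
qed

text \<open>Here \<open>U\<close> is a channel and \<open>c * U + V\<close> the pilot observation
  containing it. In \<open>|c U + V|^2 |U|^2\<close> the terms linear in \<open>V\<close> vanish
  because \<open>V\<close> is centred and independent of \<open>U\<close>; what is left is
  \<open>c^2 |U|^4 + |U|^2 |V|^2\<close>.\<close>

lemma conjugate_product_moments:
  fixes U V :: "'a \<Rightarrow> complex" and c u q s :: real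
  assumes ind: "indep_var borel U borel V"
    and U2: "has_bochner_integral M (\<lambda>\<omega>. U \<omega> * cnj (U \<omega>)) (of_real u)"
    and U4: "has_bochner_integral M (\<lambda>\<omega>. (U \<omega> * cnj (U \<omega>)) * cnj (U \<omega> * cnj (U \<omega>))) (of_real q)"
    and V1: "has_bochner_integral M V 0"
    and V2: "has_bochner_integral M (\<lambda>\<omega>. V \<omega> * cnj (V \<omega>)) (of_real s)"
    and U1: "has_bochner_integral M U 0"
  shows "has_bochner_integral M (\<lambda>\<omega>. cnj (of_real c * U \<omega> + V \<omega>) * U \<omega>) (of_real (c * u))"
    and "has_bochner_integral M (\<lambda>\<omega>. (cnj (of_real c * U \<omega> + V \<omega>) * U \<omega>) *
        cnj (cnj (of_real c * U \<omega> + V \<omega>) * U \<omega>)) (of_real (c\<^sup>2 * q + s * u))"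
proof -
  have [measurable]: "U \<in> borel_measurable M" "V \<in> borel_measurable M"
    using U1 V1 by (auto simp: has_bochner_integral_iff)
  \<comment> \<open>The value \<open>x\<close> is immaterial, since it gets multiplied by the mean 0
    of \<open>cnj V\<close>. Only the existence of this third moment matters, and it follows from
    the second and fourth moments.\<close>
  obtain x where U3: "has_bochner_integral M (\<lambda>\<omega>. (U \<omega> * cnj (U \<omega>)) * U \<omega>) x"
  proof -
    have "integrable M (\<lambda>\<omega>. (U \<omega> * cnj (U \<omega>)) * U \<omega>)"
      by (rule integrable_mult_of_square_integrable) (use U2 U4 in \<open>auto simp: has_bochner_integral_iff\<close>)
    then show ?thesis using that by (auto simp: has_bochner_integral_iff)
  qed
  have V1': "has_bochner_integral M (\<lambda>\<omega>. cnj (V \<omega>)) 0"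
    using has_bochner_integral_cnj[OF V1] by simp
  have UV: "has_bochner_integral M (\<lambda>\<omega>. U \<omega> * cnj (V \<omega>)) 0"
    using has_bochner_integral_indep_mult[OF ind, of "\<lambda>x. x" cnj 0 0] U1 V1' by simp
  have UUVV: "has_bochner_integral M (\<lambda>\<omega>. (U \<omega> * cnj (U \<omega>)) * (V \<omega> * cnj (V \<omega>))) (of_real u * of_real s)"
    by (rule has_bochner_integral_indep_mult[OF ind, of "\<lambda>x. x * cnj x" "\<lambda>x. x * cnj x"]) (use U2 V2 in auto)
  have U3V: "has_bochner_integral M (\<lambda>\<omega>. ((U \<omega> * cnj (U \<omega>)) * U \<omega>) * cnj (V \<omega>)) (x * 0)"
    by (rule has_bochner_integral_indep_mult[OF ind, of "\<lambda>x. (x * cnj x) * x" "\<lambda>x. cnj x"]) (use U3 V1' in auto)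
  have V3U: "has_bochner_integral M (\<lambda>\<omega>. cnj (((U \<omega> * cnj (U \<omega>)) * U \<omega>) * cnj (V \<omega>))) 0"
    using has_bochner_integral_cnj[OF U3V] by simp
  show "has_bochner_integral M (\<lambda>\<omega>. cnj (of_real c * U \<omega> + V \<omega>) * U \<omega>) (of_real (c * u))"
    by (rule has_bochner_integral_eqI[OF has_bochner_integral_add[OF
          has_bochner_integral_mult_right[OF U2, of "of_real c"] UV]])
       (auto simp: algebra_simps)
  show "has_bochner_integral M (\<lambda>\<omega>. (cnj (of_real c * U \<omega> + V \<omega>) * U \<omega>) *
        cnj (cnj (of_real c * U \<omega> + V \<omega>) * U \<omega>)) (of_real (c\<^sup>2 * q + s * u))"
    by (rule has_bochner_integral_eqI[OF has_bochner_integral_add[OF has_bochner_integral_add[OF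
          has_bochner_integral_mult_right[OF U4, of "of_real (c\<^sup>2)"] UUVV] has_bochner_integral_add[OF
          has_bochner_integral_mult_right[OF U3V, of "of_real c"]
          has_bochner_integral_mult_right[OF V3U, of "of_real c"]]]])
       (auto simp: algebra_simps power2_eq_square)
qed

section \<open>Moments of the elementary laws: Gaussian, uniform phase, Rician\<close>

lemma normal_moments:
  assumes D: "distributed M lborel X (normal_density 0 (sqrt v))" and "0 < v"
  shows "has_bochner_integral M (\<lambda>\<omega>. X \<omega> ^ 1) 0"
    "has_bochner_integral M (\<lambda>\<omega>. X \<omega> ^ 2) v"
    "has_bochner_integral M (\<lambda>\<omega>. X \<omega> ^ 3) 0"
    "has_bochner_integral M (\<lambda>\<omega>. X \<omega> ^ 4) (3 * v\<^sup>2)"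
proof -
  have s: "0 < sqrt v" using assms by simp
  \<comment> \<open>The factor \<open>(x - 0) ^ n\<close> is the centred power of the library moment
    formulas at mean 0.\<close>
  have *: "has_bochner_integral M (\<lambda>\<omega>. X \<omega> ^ n) y"
    if "has_bochner_integral lborel (\<lambda>x. normal_density 0 (sqrt v) x * (x - 0) ^ n) y" for n y
    using that distributed_integral[OF D, of "\<lambda>x. x ^ n"] distributed_integrable[OF D, of "\<lambda>x. x ^ n"]
    by (simp add: has_bochner_integral_iff)
  show "has_bochner_integral M (\<lambda>\<omega>. X \<omega> ^ 1) 0"
    by (rule *) (use normal_moment_odd[OF s, of 0 0] in simp)
  show "has_bochner_integral M (\<lambda>\<omega>. X \<omega> ^ 2) v"
    by (rule *) (use normal_moment_even[OF s, of 0 1] \<open>0 < v\<close> in \<open>simp add: fact_numeral\<close>)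
  show "has_bochner_integral M (\<lambda>\<omega>. X \<omega> ^ 3) 0"
    by (rule *) (use normal_moment_odd[OF s, of 0 1] in simp)
  show "has_bochner_integral M (\<lambda>\<omega>. X \<omega> ^ 4) (3 * v\<^sup>2)"
    by (rule *) (use normal_moment_even[OF s, of 0 2] \<open>0 < v\<close> in \<open>simp add: fact_numeral power2_eq_square field_simps\<close>)
qed

text \<open>Real and imaginary parts are independent, each of variance \<open>v / 2\<close>. Equal
  variances cancel in \<open>E g^2\<close>, odd powers vanish, and
  \<open>E |g|^4 = 2 * 3 (v/2)^2 + 2 (v/2)^2 = 2 v^2\<close>.\<close>

lemma cscg_moments:
  assumes g: "cscg M g v" and v: "0 < v"
  shows "has_bochner_integral M g 0"
    and "has_bochner_integral M (\<lambda>\<omega>. g \<omega> * g \<omega>) 0"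
    and "has_bochner_integral M (\<lambda>\<omega>. g \<omega> * cnj (g \<omega>)) (of_real v)"
    and "has_bochner_integral M (\<lambda>\<omega>. g \<omega> * g \<omega> * cnj (g \<omega>)) 0"
    and "has_bochner_integral M (\<lambda>\<omega>. (g \<omega> * cnj (g \<omega>)) * (g \<omega> * cnj (g \<omega>))) (of_real (2 * v\<^sup>2))"
proof -
  define x y where "x \<omega> = Re (g \<omega>)" and "y \<omega> = Im (g \<omega>)" for \<omega>
  have ind: "indep_var borel x borel y"
    using g by (simp add: cscg_def x_def[abs_def] y_def[abs_def])
  have geq: "g \<omega> = of_real (x \<omega>) + \<i> * of_real (y \<omega>)" for \<omega>
    by (simp add: x_def y_def complex_eq)
  have mx: "has_bochner_integral M (\<lambda>\<omega>. x \<omega> ^ 1) 0"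
    "has_bochner_integral M (\<lambda>\<omega>. x \<omega> ^ 2) (v/2)"
    "has_bochner_integral M (\<lambda>\<omega>. x \<omega> ^ 3) 0"
    "has_bochner_integral M (\<lambda>\<omega>. x \<omega> ^ 4) (3 * (v/2)\<^sup>2)"
    using g v normal_moments[of x "v/2"] by (auto simp: cscg_def x_def[abs_def])
  have my: "has_bochner_integral M (\<lambda>\<omega>. y \<omega> ^ 1) 0"
    "has_bochner_integral M (\<lambda>\<omega>. y \<omega> ^ 2) (v/2)"
    "has_bochner_integral M (\<lambda>\<omega>. y \<omega> ^ 3) 0"
    "has_bochner_integral M (\<lambda>\<omega>. y \<omega> ^ 4) (3 * (v/2)\<^sup>2)"
    using g v normal_moments[of y "v/2"] by (auto simp: cscg_def y_def[abs_def])
  have mxy: "has_bochner_integral M (\<lambda>\<omega>. x \<omega> ^ i * y \<omega> ^ j) (a * b)"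
    if "has_bochner_integral M (\<lambda>\<omega>. x \<omega> ^ i) a" "has_bochner_integral M (\<lambda>\<omega>. y \<omega> ^ j) b" for i j a b
  proof -
    have "indep_var borel ((\<lambda>t. t ^ i) \<circ> x) borel ((\<lambda>t. t ^ j) \<circ> y)"
      by (rule indep_var_compose[OF ind]) auto
    then have i: "indep_var borel (\<lambda>\<omega>. x \<omega> ^ i) borel (\<lambda>\<omega>. y \<omega> ^ j)"
      by (simp add: comp_def)
    show ?thesis
      using indep_var_lebesgue_integral[OF i] indep_var_integrable[OF i] that
      by (simp add: has_bochner_integral_iff)
  qed
  note R = has_bochner_integral_complex_of_real
  note S = has_bochner_integral_mult_right
  note P = has_bochner_integral_add
  show "has_bochner_integral M g 0"
    by (rule has_bochner_integral_eqI[OF P[OF R[OF mx(1)] S[OF R[OF my(1)], of \<i>]]]) (auto simp: geq)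
  show "has_bochner_integral M (\<lambda>\<omega>. g \<omega> * g \<omega>) 0"
    by (rule has_bochner_integral_eqI[OF P[OF P[OF R[OF mx(2)] S[OF R[OF my(2)], of "-1"]]
          S[OF R[OF mxy[OF mx(1) my(1)]], of "2 * \<i>"]]])
       (auto simp: geq algebra_simps power2_eq_square)
  show "has_bochner_integral M (\<lambda>\<omega>. g \<omega> * cnj (g \<omega>)) (of_real v)"
    by (rule has_bochner_integral_eqI[OF P[OF R[OF mx(2)] R[OF my(2)]]])
       (auto simp: geq algebra_simps power2_eq_square)
  show "has_bochner_integral M (\<lambda>\<omega>. g \<omega> * g \<omega> * cnj (g \<omega>)) 0"
    by (rule has_bochner_integral_eqI[OF P[OF P[OF R[OF mx(3)] S[OF R[OF my(3)], of \<i>]]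
          P[OF S[OF R[OF mxy[OF mx(2) my(1)]], of \<i>] R[OF mxy[OF mx(1) my(2)]]]]])
       (auto simp: geq algebra_simps power2_eq_square power3_eq_cube)
  show "has_bochner_integral M (\<lambda>\<omega>. (g \<omega> * cnj (g \<omega>)) * (g \<omega> * cnj (g \<omega>))) (of_real (2 * v\<^sup>2))"
    by (rule has_bochner_integral_eqI[OF P[OF P[OF R[OF mx(4)] R[OF my(4)]]
          S[OF R[OF mxy[OF mx(2) my(2)]], of 2]]])
       (auto simp: geq algebra_simps power2_eq_square power4_eq_xxxx)
qed

text \<open>Cosine and sine integrate to zero over a full period.\<close>

lemma uniform_phase_mean:
  assumes D: "distributed M lborel X (\<lambda>x. indicator {-pi..pi} x / measure lborel {-pi..pi})"
  shows "has_bochner_integral M (\<lambda>\<omega>. cis (X \<omega>)) 0"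
proof -
  have [measurable]: "X \<in> borel_measurable M" using distributed_measurable[OF D] by simp
  have zero: "expectation (\<lambda>\<omega>. f (X \<omega>)) = 0"
    if "(\<integral>x. indicator {-pi..pi} x *\<^sub>R f x \<partial>lborel) = 0" and [measurable]: "f \<in> borel_measurable borel" for f :: "real \<Rightarrow> real"
  proof -
    have "expectation (\<lambda>\<omega>. f (X \<omega>)) = (\<integral>x. (indicator {-pi..pi} x / measure lborel {-pi..pi}) * f x \<partial>lborel)"
      by (subst distributed_integral[OF D]) auto
    also have "\<dots> = (\<integral>x. (indicator {-pi..pi} x *\<^sub>R f x) / measure lborel {-pi..pi} \<partial>lborel)"
      by (simp add: ac_simps)
    also have "\<dots> = 0" by (simp only: integral_divide_zero that div_0)
    finally show ?thesis .
  qed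
  have c: "expectation (\<lambda>\<omega>. cos (X \<omega>)) = 0"
  proof (rule zero)
    have "has_bochner_integral lborel (\<lambda>x. indicator {-pi..pi} x *\<^sub>R cos x) (sin pi - sin (-pi))"
      by (rule has_bochner_integral_FTC_Icc) (auto intro!: derivative_eq_intros continuous_intros simp flip: has_real_derivative_iff_has_vector_derivative)
    then show "(\<integral>x. indicator {-pi..pi} x *\<^sub>R cos x \<partial>lborel) = 0"
      by (simp add: has_bochner_integral_iff)
  qed simp
  have s: "expectation (\<lambda>\<omega>. sin (X \<omega>)) = 0"
  proof (rule zero)
    have "has_bochner_integral lborel (\<lambda>x. indicator {-pi..pi} x *\<^sub>R sin x) (- cos pi - (- cos (-pi)))"
      by (rule has_bochner_integral_FTC_Icc) (auto intro!: derivative_eq_intros continuous_intros simp flip: has_real_derivative_iff_has_vector_derivative)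
    then show "(\<integral>x. indicator {-pi..pi} x *\<^sub>R sin x \<partial>lborel) = 0"
      by (simp add: has_bochner_integral_iff)
  qed simp
  have "integrable M (\<lambda>\<omega>. cos (X \<omega>))" "integrable M (\<lambda>\<omega>. sin (X \<omega>))"
    by (auto intro!: integrable_const_bound[where B=1])
  with c s have c': "has_bochner_integral M (\<lambda>\<omega>. cos (X \<omega>)) 0" and s': "has_bochner_integral M (\<lambda>\<omega>. sin (X \<omega>)) 0"
    by (auto simp: has_bochner_integral_iff)
  show ?thesis
    by (rule has_bochner_integral_eqI[OF has_bochner_integral_add[OF has_bochner_integral_complex_of_real[OF c']
          has_bochner_integral_mult_right[OF has_bochner_integral_complex_of_real[OF s'], of \<i>]]])
       (auto simp: complex_eq_iff)
qed

text \<open>Expanding \<open>|H p + g|^4\<close> with \<open>|p| = 1\<close> gives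
  \<open>H^4 + 4 H^2 |g|^2 + |g|^4\<close> plus multiples of \<open>p * cnj g\<close>,
  \<open>p^2 * cnj (g^2)\<close>, \<open>p * cnj (g^2 * cnj g)\<close> and their conjugates. These
  have mean zero by the independence of \<open>p\<close> and \<open>g\<close> and the vanishing
  moments of \<open>g\<close>.\<close>

lemma rician_moments:
  fixes p g :: "'a \<Rightarrow> complex" and H v :: real
  assumes ind: "indep_var borel p borel g"
    and unit: "\<And>\<omega>. cmod (p \<omega>) = 1"
    and p: "has_bochner_integral M p 0"
    and g: "cscg M g v" and v: "0 < v"
  defines "h \<equiv> \<lambda>\<omega>. of_real H * p \<omega> + g \<omega>"
  shows "has_bochner_integral M h 0"
    and "has_bochner_integral M (\<lambda>\<omega>. h \<omega> * cnj (h \<omega>)) (of_real (v + H\<^sup>2))"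
    and "has_bochner_integral M (\<lambda>\<omega>. (h \<omega> * cnj (h \<omega>)) * cnj (h \<omega> * cnj (h \<omega>)))
      (of_real (H^4 + 4 * H\<^sup>2 * v + 2 * v\<^sup>2))"
proof -
  have [measurable]: "p \<in> borel_measurable M" using p by (auto simp: has_bochner_integral_iff)
  note gm = cscg_moments[OF g v]
  note J = has_bochner_integral_indep_mult[OF ind, where f="\<lambda>x. x"]
  note J2 = has_bochner_integral_indep_mult[OF ind, where f="\<lambda>x. x * x"]
  note C = has_bochner_integral_cnj
  note S = has_bochner_integral_mult_right
  note P = has_bochner_integral_add
  have pp: "p \<omega> * cnj (p \<omega>) = 1" "cnj (p \<omega>) * p \<omega> = 1" for \<omega>
    using unit[of \<omega>] complex_norm_square[of "p \<omega>"] by (auto simp: mult.commute)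
  \<comment> \<open>\<open>E p^2\<close> is left as an unknown \<open>z\<close>, because it only
    multiplies \<open>E cnj (g^2) = 0\<close>. Boundedness of \<open>p\<close> gives its
    existence.\<close>
  obtain z where z: "has_bochner_integral M (\<lambda>\<omega>. p \<omega> * p \<omega>) z"
  proof -
    have "integrable M (\<lambda>\<omega>. p \<omega> * p \<omega>)"
      by (rule integrable_const_bound[where B=1]) (auto simp: norm_mult unit)
    then show ?thesis using that by (auto simp: has_bochner_integral_iff)
  qed
  have one: "has_bochner_integral M (\<lambda>\<omega>. 1) (1::complex)"
    by (simp add: has_bochner_integral_iff prob_space)
  have pg: "has_bochner_integral M (\<lambda>\<omega>. p \<omega> * cnj (g \<omega>)) 0"
    using J[of cnj 0 0] p C[OF gm(1)] by simp
  have ppgg: "has_bochner_integral M (\<lambda>\<omega>. (p \<omega> * p \<omega>) * cnj (g \<omega> * g \<omega>)) 0"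
    using J2[of "\<lambda>x. cnj (x * x)" z 0] z C[OF gm(2)] by simp
  have pggg: "has_bochner_integral M (\<lambda>\<omega>. p \<omega> * cnj (g \<omega> * g \<omega> * cnj (g \<omega>))) 0"
    using J[of "\<lambda>x. cnj (x * x * cnj x)" 0 0] p C[OF gm(4)] by simp
  show "has_bochner_integral M h 0"
    unfolding h_def using P[OF S[OF p, of "of_real H"] gm(1)] by simp
  show "has_bochner_integral M (\<lambda>\<omega>. h \<omega> * cnj (h \<omega>)) (of_real (v + H\<^sup>2))"
  proof (rule has_bochner_integral_eqI[OF P[OF P[OF S[OF one, of "of_real (H^2)"] gm(3)]
          P[OF S[OF pg, of "of_real H"] S[OF C[OF pg], of "of_real H"]]]])
    fix \<omega>
    have "h \<omega> * cnj (h \<omega>) = of_real (H^2) * (p \<omega> * cnj (p \<omega>)) + g \<omega> * cnj (g \<omega>)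
      + (of_real H * (p \<omega> * cnj (g \<omega>)) + of_real H * (cnj (p \<omega>) * g \<omega>))"
      unfolding h_def by (simp add: algebra_simps power2_eq_square)
    then show "h \<omega> * cnj (h \<omega>) = of_real (H^2) * 1 + g \<omega> * cnj (g \<omega>)
      + (of_real H * (p \<omega> * cnj (g \<omega>)) + of_real H * cnj (p \<omega> * cnj (g \<omega>)))"
      by (simp add: pp)
  qed simp
  show "has_bochner_integral M (\<lambda>\<omega>. (h \<omega> * cnj (h \<omega>)) * cnj (h \<omega> * cnj (h \<omega>)))
      (of_real (H^4 + 4 * H\<^sup>2 * v + 2 * v\<^sup>2))"
  proof (rule has_bochner_integral_eqI[OF P[OF P[OF P[OF S[OF one, of "of_real (H^4)"] S[OF gm(3), of "of_real (4*H^2)"]] gm(5)]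
          P[OF P[OF P[OF S[OF pg, of "of_real (2*H^3)"] S[OF C[OF pg], of "of_real (2*H^3)"]]
               P[OF S[OF ppgg, of "of_real (H^2)"] S[OF C[OF ppgg], of "of_real (H^2)"]]]
               P[OF S[OF pggg, of "of_real (2*H)"] S[OF C[OF pggg], of "of_real (2*H)"]]]]])
    fix \<omega>
    let ?p = "p \<omega>" and ?P = "cnj (p \<omega>)" and ?g = "g \<omega>" and ?G = "cnj (g \<omega>)"
    \<comment> \<open>A polynomial identity in \<open>?p\<close>, \<open>?P\<close>,
      \<open>?g\<close>, \<open>?G\<close>. The products \<open>?p * ?P\<close> stay explicit so
      that \<open>pp\<close> can turn them into 1 afterwards.\<close>
    have "(h \<omega> * cnj (h \<omega>)) * cnj (h \<omega> * cnj (h \<omega>)) = of_real (H^4) * ((?p * ?P) * (?p * ?P))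
      + of_real (4*H^2) * (?p * ?P) * (?g * ?G) + (?g * ?G) * (?g * ?G)
      + (of_real (2*H^3) * (?p * ?P) * (?p * ?G) + of_real (2*H^3) * (?p * ?P) * (?P * ?g)
        + (of_real (H^2) * (?p * ?p * (?G * ?G)) + of_real (H^2) * (?P * ?P * (?g * ?g)))
        + (of_real (2*H) * (?p * (?G * ?G * ?g)) + of_real (2*H) * (?P * (?g * ?g * ?G))))"
      unfolding h_def by (simp add: algebra_simps power2_eq_square power3_eq_cube power4_eq_xxxx)
    then show "(h \<omega> * cnj (h \<omega>)) * cnj (h \<omega> * cnj (h \<omega>)) = of_real (H^4) * 1
      + of_real (4*H^2) * (?g * ?G) + (?g * ?G) * (?g * ?G)
      + (of_real (2*H^3) * (?p * ?G) + of_real (2*H^3) * cnj (?p * ?G)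
        + (of_real (H^2) * (?p * ?p * cnj (?g * ?g)) + of_real (H^2) * cnj (?p * ?p * cnj (?g * ?g)))
        + (of_real (2*H) * (?p * cnj (?g * ?g * ?G)) + of_real (2*H) * cnj (?p * cnj (?g * ?g * ?G))))"
      by (simp add: pp)
  qed simp
qed

end

section \<open>Diagonal matrices and Rayleigh quotients\<close>

lemma hdot_add_right: "hdot u (v + w) = hdot u v + hdot u w"
  by (simp add: hdot_def algebra_simps sum.distrib)

lemma hdot_diff_right: "hdot u (v - w) = hdot u v - hdot u w"
  by (simp add: hdot_def algebra_simps sum_subtractf)

lemma hdot_diff_left: "hdot (u - v) w = hdot u w - hdot v w"
  by (simp add: hdot_def algebra_simps sum_subtractf)

lemma hdot_scale_right: "hdot u (c *s v) = c * hdot u v"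
  by (simp add: hdot_def sum_distrib_left ac_simps)

lemma hdot_scale_left: "hdot (c *s u) v = cnj c * hdot u v"
  by (simp add: hdot_def sum_distrib_left ac_simps)

lemma hdot_scaleR_right: "hdot u (c *\<^sub>R v) = of_real c * hdot u v"
  by (simp add: hdot_def sum_distrib_left)
     (simp add: scaleR_conv_of_real)

lemma cnj_hdot: "cnj (hdot u v) = hdot v u"
  by (simp add: hdot_def ac_simps)

lemma hdot_zero_right [simp]: "hdot u 0 = 0"
  by (simp add: hdot_def)

lemma hdot_axis: "hdot (axis i 1) v = v $ i"
proof -
  have "hdot (axis i 1) v = (\<Sum>j\<in>UNIV. if j = i then v $ j else 0)"
    unfolding hdot_def by (rule sum.cong) (auto simp: axis_def)
  then show ?thesis by simp
qed

lemma hdot_eqI: "(\<And>u. hdot u v = hdot u w) \<Longrightarrow> v = w"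
  by (metis hdot_axis vec_eq_iff)

lemma hdot_form_add: "hdot u ((A + B) *v v) = hdot u (A *v v) + hdot u (B *v v)"
  by (simp add: matrix_vector_mult_add_rdistrib hdot_add_right)

lemma hdot_form_diff: "hdot u ((A - B) *v v) = hdot u (A *v v) - hdot u (B *v v)"
  by (simp add: matrix_vector_mult_diff_rdistrib hdot_diff_right)

lemma hdot_form_scaleR: "hdot u ((c *\<^sub>R A) *v v) = of_real c * hdot u (A *v v)"
  for A :: "complex ^ 'n ^ 'm"
proof -
  have "(c *\<^sub>R A) *v v = c *\<^sub>R (A *v v)"
    by (simp add: vec_eq_iff matrix_vector_mult_def scaleR_sum_right)
  then show ?thesis by (simp add: hdot_scaleR_right)
qed

lemma hdot_form_sum: "hdot u ((\<Sum>i\<in>I. A i) *v v) = (\<Sum>i\<in>I. hdot u (A i *v v))"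
  by (induction I rule: infinite_finite_induct) (auto simp: hdot_form_add)

lemma hdot_form_houter: "hdot u (houter g h *v v) = hdot u g * hdot h v"
proof -
  have "hdot u (houter g h *v v) = (\<Sum>i\<in>UNIV. \<Sum>j\<in>UNIV. cnj (u $ i) * g $ i * (cnj (h $ j) * v $ j))"
    by (simp add: hdot_def houter_def matrix_vector_mult_def sum_distrib_left mult.assoc)
  also have "\<dots> = hdot u g * hdot h v"
    by (simp add: hdot_def sum_product)
  finally show ?thesis .
qed

section \<open>Diagonal matrices, inverses and traces\<close>

lemma diag_mat_mult_vec: "diag_mat d *v v = (\<chi> i. d $ i * v $ i)"
  by (simp add: diag_mat_def matrix_vector_mult_def vec_eq_iff if_distrib[of "\<lambda>x. x * _"] cong: if_cong)

lemma hdot_form_diag: "hdot u (diag_mat d *v v) = (\<Sum>i\<in>UNIV. cnj (u $ i) * d $ i * v $ i)"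
  by (simp add: diag_mat_mult_vec hdot_def ac_simps)

lemma diag_mat_mult: "diag_mat d ** diag_mat e = diag_mat (\<chi> i. d $ i * e $ i)"
  by (auto simp: diag_mat_def matrix_matrix_mult_def vec_eq_iff if_distrib[of "\<lambda>x. x * _"] cong: if_cong)

lemma diag_mat_add: "diag_mat d + diag_mat e = diag_mat (\<chi> i. d $ i + e $ i)"
  by (auto simp: diag_mat_def vec_eq_iff)

lemma diag_mat_diff: "diag_mat d - diag_mat e = diag_mat (\<chi> i. d $ i - e $ i)"
  by (auto simp: diag_mat_def vec_eq_iff)

lemma diag_mat_scaleR: "c *\<^sub>R diag_mat d = diag_mat (\<chi> i. c *\<^sub>R d $ i)"
  by (auto simp: diag_mat_def vec_eq_iff)

lemma hadj_diag_mat: "hadj (diag_mat d) = diag_mat (\<chi> i. cnj (d $ i))"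
  by (auto simp: diag_mat_def hadj_def vec_eq_iff)

lemma trace_diag_mat: "trace (diag_mat d) = (\<Sum>i\<in>UNIV. d $ i)"
  by (simp add: trace_def diag_mat_def)

lemma diag_vec_diag_mat [simp]: "diag_vec (diag_mat d) = d"
  by (simp add: diag_vec_def diag_mat_def vec_eq_iff)

lemma
  fixes A :: "complex ^ 'n ^ 'n"
  assumes "invertible A"
  shows matrix_inv_right: "A ** matrix_inv A = mat 1"
    and matrix_inv_left: "matrix_inv A ** A = mat 1"
  using someI_ex[OF assms[unfolded invertible_def]] by (auto simp: matrix_inv_def)

lemma matrix_inv_eqI:
  fixes A :: "complex ^ 'n ^ 'n"
  assumes "A ** B = mat 1" "B ** A = mat 1"
  shows "matrix_inv A = B"
proof -
  have "invertible A" using assms by (auto simp: invertible_def)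
  then have "matrix_inv A ** A = mat 1" by (rule matrix_inv_left)
  then have "matrix_inv A ** A ** B = B" by simp
  with assms show ?thesis by (simp add: matrix_mul_assoc[symmetric])
qed

lemma matrix_inv_diag_mat:
  assumes "\<And>i. d $ i \<noteq> 0"
  shows "matrix_inv (diag_mat d) = diag_mat (\<chi> i. inverse (d $ i))"
proof -
  have "diag_mat (\<chi> i. 1) = (mat 1 :: complex ^ 'n ^ 'n)"
    by (simp add: diag_mat_def mat_def vec_eq_iff)
  with assms show ?thesis by (intro matrix_inv_eqI) (auto simp: diag_mat_mult)
qed

text \<open>Turns the trace version of the SINR terms into quadratic forms of the LSFD vector. All
  factors are diagonal, so only products of entries have to be compared.\<close>

lemma trace_hadj_diag_mat:
  "trace (hadj (diag_mat a) ** diag_mat d ** diag_mat a) = hdot a (diag_mat d *v a)"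
  by (simp add: hadj_diag_mat diag_mat_mult trace_diag_mat hdot_form_diag)

lemma norm_diag_mat_mult_square:
  "(norm (diag_mat a *v v))\<^sup>2 = (\<Sum>i\<in>UNIV. (cmod (a $ i))\<^sup>2 * (cmod (v $ i))\<^sup>2)"
  by (simp add: diag_mat_mult_vec norm_vec_def L2_set_def sum_nonneg norm_mult power_mult_distrib)

lemma scaleR_complex: "c *\<^sub>R z = of_real c * z" for z :: complex
  by (rule scaleR_conv_of_real)

lemma diag_mat_zero: "diag_mat (\<chi> i. 0) = 0"
  by (simp add: diag_mat_def vec_eq_iff)

lemma diag_mat_sum_real:
  "(\<Sum>l\<in>I. p l *\<^sub>R diag_mat (\<chi> m. complex_of_real (e l m))) = diag_mat (\<chi> m. of_real (\<Sum>l\<in>I. p l * e l m))"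
  by (auto simp: diag_mat_def vec_eq_iff scaleR_complex)

lemma houter_zero [simp]: "houter 0 0 = 0"
  by (simp add: houter_def vec_eq_iff)

lemma houter_scaleR: "houter (c *\<^sub>R u) (c *\<^sub>R u) = (c\<^sup>2) *\<^sub>R houter u u"
  by (simp add: houter_def vec_eq_iff power2_eq_square)

lemma cmod_hdot_square: "complex_of_real ((cmod (hdot a b))\<^sup>2) = hdot a b * hdot b a"
  unfolding complex_norm_square cnj_hdot ..

section \<open>Positive definite Hermitian forms and the maximum of the Rayleigh quotient\<close>

locale hermitian_pd =
  fixes G :: "complex ^ 'n ^ 'n"
  assumes hermitian: "cnj (hdot u (G *v v)) = hdot v (G *v u)"
    and positive: "a \<noteq> 0 \<Longrightarrow> 0 < Re (hdot a (G *v a))"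
begin

lemma form_real: "hdot a (G *v a) = of_real (Re (hdot a (G *v a)))"
  using hermitian[of a a] by (simp add: complex_eq_iff)

lemma invertible: "invertible G"
proof -
  have "x = 0" if "G *v x = 0" for x
    using positive[of x] that by auto
  then show ?thesis
    by (auto simp: invertible_left_inverse matrix_left_invertible_ker)
qed

lemma mult_inv: "G *v (matrix_inv G *v b) = b"
  by (simp add: matrix_vector_mul_assoc matrix_inv_right[OF invertible])

lemma inj: "G *v x = G *v y \<Longrightarrow> x = y"
  by (metis invertible matrix_inv_left matrix_vector_mul_assoc matrix_vector_mul_lid)

lemma cauchy_schwarz:
  "(cmod (hdot x (G *v a)))\<^sup>2 \<le> Re (hdot a (G *v a)) * Re (hdot x (G *v x))"
proof (cases "x = 0")
  case True
  then show ?thesis by (simp add: hdot_def)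
next
  case False
  define q where "q = Re (hdot x (G *v x))"
  define t where "t = hdot x (G *v a)"
  \<comment> \<open>The coefficient of the projection of \<open>a\<close> onto \<open>x\<close> for
    the form of \<open>G\<close>, which minimises the form at \<open>a - s *s x\<close>.\<close>
  define s where "s = t / of_real q"
  have q: "0 < q" using positive[OF False] by (simp add: q_def)
  have qx: "hdot x (G *v x) = of_real q" using form_real[of x] by (simp add: q_def)
  have ax: "hdot a (G *v x) = cnj t" using hermitian[of x a] by (simp add: t_def)
  have "0 \<le> Re (hdot (a - s *s x) (G *v (a - s *s x)))"
    using positive[of "a - s *s x"] by (cases "a - s *s x = 0") auto
  also have "hdot (a - s *s x) (G *v (a - s *s x))
      = hdot a (G *v a) - s * cnj t - cnj s * t + cnj s * s * of_real q"
    by (simp add: matrix_vector_mult_diff_distrib vector_scalar_commute hdot_diff_left hdot_diff_right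
        hdot_scale_left hdot_scale_right qx ax t_def[symmetric] algebra_simps)
  also have "\<dots> = hdot a (G *v a) - of_real ((cmod t)\<^sup>2 / q)"
    unfolding s_def of_real_divide complex_norm_square using q by (simp add: field_simps)
  finally have "(cmod t)\<^sup>2 / q \<le> Re (hdot a (G *v a))" by simp
  with q show ?thesis by (simp add: t_def q_def[symmetric] field_simps)
qed

text \<open>With \<open>x = matrix_inv G *v b\<close> the left side is
  \<open>hdot (G *v x) x\<close>, the conjugate of the real number
  \<open>hdot x (G *v x)\<close>.\<close>

lemma form_inv: "hdot b (matrix_inv G *v b) = hdot (matrix_inv G *v b) (G *v (matrix_inv G *v b))"
  using form_real[of "matrix_inv G *v b"]
  by (metis mult_inv cnj_hdot complex_cnj_complex_of_real)

lemma form_inv_real: "hdot b (matrix_inv G *v b) \<in> \<real>"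
  unfolding form_inv by (subst form_real) simp

lemma inv_nonzero: "b \<noteq> 0 \<Longrightarrow> matrix_inv G *v b \<noteq> 0"
  using mult_inv[of b] by auto

text \<open>Cauchy-Schwarz for the form of \<open>G\<close> with
  \<open>x = matrix_inv G *v b\<close>, since \<open>hdot a b = hdot a (G *v x)\<close>.\<close>

lemma rayleigh_le:
  "(cmod (hdot a b))\<^sup>2 / Re (hdot a (G *v a)) \<le> Re (hdot b (matrix_inv G *v b))"
proof (cases "a = 0")
  case True
  \<comment> \<open>At \<open>a = 0\<close> the quotient is \<open>0 / 0 = 0\<close>, so the bound
    asks for a nonnegative right side. Covering this case makes the bound available for every
    vector.\<close>
  have "0 \<le> Re (hdot b (matrix_inv G *v b))"
    unfolding form_inv using positive[of "matrix_inv G *v b"]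
    by (cases "matrix_inv G *v b = 0") auto
  with True show ?thesis by (simp add: hdot_def)
next
  case False
  have "(cmod (hdot a b))\<^sup>2 = (cmod (hdot (matrix_inv G *v b) (G *v a)))\<^sup>2"
    by (metis mult_inv hermitian complex_mod_cnj)
  also have "\<dots> \<le> Re (hdot a (G *v a)) * Re (hdot b (matrix_inv G *v b))"
    unfolding form_inv by (rule cauchy_schwarz)
  finally show ?thesis
    using positive[OF False] by (simp add: field_simps)
qed

text \<open>Both \<open>hdot a b\<close> and the denominator equal
  \<open>r = hdot a (G *v a)\<close>, and \<open>r^2 / r = r\<close> because \<open>b\<close>
  nonzero makes \<open>r\<close> positive.\<close>

lemma rayleigh_eq:
  assumes "b \<noteq> 0"
  defines "a \<equiv> matrix_inv G *v b"
  shows "(cmod (hdot a b))\<^sup>2 / Re (hdot a (G *v a)) = Re (hdot b (matrix_inv G *v b))"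
proof -
  have p: "0 < Re (hdot a (G *v a))"
    using positive inv_nonzero[OF assms(1)] by (simp add: a_def)
  have "hdot a b = of_real (Re (hdot a (G *v a)))"
    using form_real[of a] mult_inv[of b] by (simp add: a_def)
  then have "(cmod (hdot a b))\<^sup>2 = (Re (hdot a (G *v a)))\<^sup>2"
    by (metis norm_of_real power2_abs)
  moreover have "Re (hdot b (matrix_inv G *v b)) = Re (hdot a (G *v a))"
    by (simp only: a_def form_inv)
  ultimately show ?thesis
    using p by (simp add: power2_eq_square)
qed

end

section \<open>Moments of the pilot observation\<close>

lemma sum_UNIV_option:
  fixes f :: "'i::finite option \<Rightarrow> 'b::comm_monoid_add"
  shows "(\<Sum>z\<in>UNIV. f z) = f None + (\<Sum>l\<in>UNIV. f (Some l))"
  by (simp add: UNIV_option_conv sum.reindex)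

text \<open>Mapping every source to a complex number replaces independence of sigma-algebras by
  independence of one family with a single value type. Noise enters only through its correlation
  with the pilot of user \<open>k\<close>.\<close>

definition source_value ::
    "('w, 'm, 'k, 't::finite) cf_system \<Rightarrow> 'k \<Rightarrow> ('m, 'k) source \<Rightarrow> 'w \<Rightarrow> complex" where
  "source_value S k i \<omega> = (case i of
       Phase m l \<Rightarrow> cis (phase S m l \<omega>)
     | Scatter m l \<Rightarrow> scatter S m l \<omega>
     | Noise m \<Rightarrow> hdot (pilot_seq S (pilot_of S k)) (noise S m \<omega>))"

text \<open>The summands of the pilot observation: \<open>Some l\<close> is the channel of user \<open>l\<close>, \<open>None\<close> the
  despread noise.\<close>

definition link ::
    "('w, 'm::finite, 'k, 't::finite) cf_system \<Rightarrow> 'k \<Rightarrow> 'm \<times> 'k option \<Rightarrow> 'w \<Rightarrow> complex" where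
  "link S k x \<omega> = (case snd x of
       Some l \<Rightarrow> chan S l \<omega> $ fst x
     | None \<Rightarrow> hdot (pilot_seq S (pilot_of S k)) (noise S (fst x) \<omega>))"

definition coef :: "('w, 'm, 'k, 't::finite) cf_system \<Rightarrow> 'k \<Rightarrow> 'k \<Rightarrow> real" where
  "coef S k l = (if l \<in> copilot S k then sqrt (pilot_pow S l) * real (tau_p S) else 0)"

text \<open>User \<open>l\<close> is removed by a zero weight instead of a smaller index set:
  \<open>centered_linear_combination\<close> then applies over the full type, while the sum still
  depends on the other links only.\<close>

definition interference ::
    "('w, 'm::finite, 'k::finite, 't::finite) cf_system \<Rightarrow> 'k \<Rightarrow> 'k \<Rightarrow> 'm \<Rightarrow> 'w \<Rightarrow> complex" where
  "interference S k l m \<omega> =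
     (\<Sum>z\<in>UNIV. of_real (if z = Some l then 0 else case z of None \<Rightarrow> 1 | Some l' \<Rightarrow> coef S k l')
        * link S k (m, z) \<omega>)"

lemma measurable_hdot [measurable]: "hdot u \<in> borel_measurable borel"
  unfolding hdot_def[abs_def]
  by (intro borel_measurable_continuous_onI continuous_intros)

lemma measurable_cis [measurable]: "cis \<in> borel_measurable borel"
  by (intro borel_measurable_continuous_onI continuous_intros)

text \<open>The choice of \<open>l\<close> is free: for a user outside the copilot set the
  coefficient is 0 and the whole observation counts as interference.\<close>

lemma pilot_obs_split:
  "pilot_obs S k \<omega> $ m = of_real (coef S k l) * chan S l \<omega> $ m + interference S k l m \<omega>"
proof -
  have "(\<Sum>i\<in>copilot S k. complex_of_real (sqrt (pilot_pow S i) * real (tau_p S)) * chan S i \<omega> $ m)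
     = (\<Sum>i\<in>UNIV. of_real (coef S k i) * chan S i \<omega> $ m)"
    by (rule sum.mono_neutral_cong_left) (auto simp: coef_def)
  also have "\<dots> = of_real (coef S k l) * chan S l \<omega> $ m
      + (\<Sum>i\<in>UNIV. of_real (if i = l then 0 else coef S k i) * chan S i \<omega> $ m)"
    by (simp add: sum.remove[of UNIV l] cong: if_cong)
  finally show ?thesis
    by (simp add: pilot_obs_def interference_def sum_UNIV_option link_def cong: if_cong)
qed

context cell_free
begin

section \<open>Positivity and the mean power of the pilot observation\<close>

lemma tau_p_pos: "0 < real (tau_p S)"
  by (simp add: tau_p_def)

lemma beta'_pos: "0 < beta' S m l"
  using beta_pos[of m l] by (simp add: beta'_def add_pos_nonneg)

lemma coef_pos: "l \<in> copilot S k \<Longrightarrow> 0 < coef S k l"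
  using pilot_pow_pos[of l] tau_p_pos by (simp add: coef_def)

lemma coef_square:
  "(coef S k l)\<^sup>2 = (if l \<in> copilot S k then pilot_pow S l * (real (tau_p S))\<^sup>2 else 0)"
  using pilot_pow_pos[of l] by (simp add: coef_def power_mult_distrib)

text \<open>The right side adds the powers of all summands of the pilot observation, so the left
  side is its mean power; \<open>lambda'\<close> itself carries one factor \<open>tau_p\<close>
  less.\<close>

lemma tau_lambda':
  "real (tau_p S) * lambda' S m k
    = (\<Sum>l\<in>UNIV. (coef S k l)\<^sup>2 * beta' S m l) + real (tau_p S) * sigma2 S"
proof -
  have "(\<Sum>l\<in>UNIV. (coef S k l)\<^sup>2 * beta' S m l)
      = (\<Sum>l\<in>copilot S k. pilot_pow S l * (real (tau_p S))\<^sup>2 * beta' S m l)"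
    by (rule sum.mono_neutral_cong_right) (auto simp: coef_square)
  then show ?thesis
    by (simp add: lambda'_def algebra_simps sum_distrib_left power2_eq_square)
qed

lemma lambda'_pos: "0 < lambda' S m k"
  unfolding lambda'_def
  using sigma2_pos pilot_pow_pos tau_p_pos beta'_pos
  by (intro add_nonneg_pos sum_nonneg) (auto intro!: mult_nonneg_nonneg less_imp_le)

text \<open>The share of one user in the mean power is at most the total. This is what keeps
  \<open>load\<close> positive.\<close>

lemma coef_beta'_le: "(coef S k l)\<^sup>2 * beta' S m l \<le> real (tau_p S) * lambda' S m k"
proof -
  have "(coef S k l)\<^sup>2 * beta' S m l \<le> (\<Sum>l\<in>UNIV. (coef S k l)\<^sup>2 * beta' S m l)"
    by (rule member_le_sum) (auto intro!: mult_nonneg_nonneg less_imp_le[OF beta'_pos])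
  also have "\<dots> \<le> real (tau_p S) * lambda' S m k"
    unfolding tau_lambda' using tau_p_pos sigma2_pos by simp
  finally show ?thesis .
qed

section \<open>Measurability and independence of sources and links\<close>

lemma noise_measurable [measurable]: "noise S m \<in> borel_measurable (pspace S)"
proof -
  have 1: "(\<lambda>\<omega>. noise S m \<omega> $ i) \<in> borel_measurable (pspace S)" for i
    using noise_gaussian[of m] by (auto simp: cscg_vec_def indep_vars_def)
  then have "(\<lambda>\<omega>. noise S m \<omega> $ i \<bullet> b) \<in> borel_measurable (pspace S)" for i b
    by simp
  then show ?thesis
    by (subst borel_measurable_euclidean_space) (auto simp: Basis_vec_def inner_axis)
qed

lemma scatter_measurable [measurable]: "scatter S m l \<in> borel_measurable (pspace S)"
  by (rule borel_measurable_has_bochner_integral[OF cscg_moments(1)[OF scatter_gaussian beta_pos]])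

lemma phase_measurable [measurable]: "phase S m l \<in> borel_measurable (pspace S)"
  using distributed_measurable[OF phase_uniform] by simp

text \<open>Preimages under \<open>f\<close> after \<open>X\<close> are preimages under
  \<open>X\<close>, so the events of each value lie in the sigma-algebra of its source, and
  independence passes to smaller collections.\<close>

lemma indep_source_value: "indep_vars (\<lambda>_. borel) (source_value S k) UNIV"
  unfolding indep_vars_def2
proof (intro conjI ballI)
  show "random_variable borel (source_value S k i)" for i
    unfolding source_value_def[abs_def] by (cases i) auto
  have *: "{(\<lambda>\<omega>. f (X \<omega>)) -` A \<inter> space (pspace S) |A. A \<in> sets borel}
      \<subseteq> sets (vimage_algebra (space (pspace S)) X borel)"
    if f[measurable]: "f \<in> borel_measurable borel" for X :: "'w \<Rightarrow> 'z::topological_space" and f :: "'z \<Rightarrow> complex"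
  proof safe
    fix A :: "complex set" assume "A \<in> sets borel"
    then have "f -` A \<in> sets borel"
      using measurable_sets[OF f] by simp
    moreover have "(\<lambda>\<omega>. f (X \<omega>)) -` A \<inter> space (pspace S) = X -` (f -` A) \<inter> space (pspace S)"
      by auto
    ultimately show "(\<lambda>\<omega>. f (X \<omega>)) -` A \<inter> space (pspace S) \<in> sets (vimage_algebra (space (pspace S)) X borel)"
      by (simp add: in_vimage_algebra)
  qed
  show "indep_sets (\<lambda>i. {source_value S k i -` A \<inter> space (pspace S) |A. A \<in> sets borel}) UNIV"
  proof (rule indep_sets_mono_sets[OF sources_indep])
    fix i :: "('m, 'k) source"
    show "{source_value S k i -` A \<inter> space (pspace S) |A. A \<in> sets borel} \<subseteq> source_events S i"
    proof (cases i)
      case (Phase m l)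
      then show ?thesis
        using *[of cis "phase S m l"] by (simp add: source_value_def[abs_def])
    next
      case (Scatter m l)
      then show ?thesis
        using *[of "\<lambda>x. x" "scatter S m l"] by (simp add: source_value_def[abs_def])
    next
      case (Noise m)
      then show ?thesis
        using *[of "hdot (pilot_seq S (pilot_of S k))" "noise S m"] by (simp add: source_value_def[abs_def])
    qed
  qed
qed

text \<open>Link \<open>(m, Some l)\<close> uses the sources \<open>Phase m l\<close> and
  \<open>Scatter m l\<close>, link \<open>(m, None)\<close> only \<open>Noise m\<close>, and these
  blocks are disjoint.\<close>

lemma indep_link: "indep_vars (\<lambda>_. borel) (link S k) UNIV"
proof (rule indep_vars_group[OF indep_source_value[of k]])
  let ?K = "\<lambda>(m, z). case z of Some l \<Rightarrow> {Phase m l, Scatter m l} | None \<Rightarrow> {Noise m}"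
  let ?F = "\<lambda>x f. case snd x of Some l \<Rightarrow> complex_of_real (hbar S (fst x) l) * f (Phase (fst x) l) + f (Scatter (fst x) l)
    | None \<Rightarrow> f (Noise (fst x))"
  show "disjoint_family_on ?K UNIV"
    by (auto simp: disjoint_family_on_def split: option.splits)
  show "?F x \<in> borel_measurable (PiM (?K x) (\<lambda>_. borel))" for x
    by (cases x; cases "snd x") auto
  show "link S k x \<omega> = ?F x (restrict (\<lambda>i. source_value S k i \<omega>) (?K x))" for x \<omega>
    by (cases x; cases "snd x") (auto simp: link_def source_value_def chan_def)
qed

section \<open>Moments of channels, noise, interference and their products\<close>

lemma chan_moments:
  shows "has_bochner_integral (pspace S) (\<lambda>\<omega>. chan S l \<omega> $ m) 0"
    and "has_bochner_integral (pspace S) (\<lambda>\<omega>. chan S l \<omega> $ m * cnj (chan S l \<omega> $ m)) (of_real (beta' S m l))"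
    and "has_bochner_integral (pspace S)
      (\<lambda>\<omega>. (chan S l \<omega> $ m * cnj (chan S l \<omega> $ m)) * cnj (chan S l \<omega> $ m * cnj (chan S l \<omega> $ m)))
      (of_real ((hbar S m l)^4 + 4 * (hbar S m l)\<^sup>2 * beta S m l + 2 * (beta S m l)\<^sup>2))"
proof -
  have ind: "indep_var borel (\<lambda>\<omega>. cis (phase S m l \<omega>)) borel (scatter S m l)"
    using indep_vars_pair[OF indep_source_value, of "Phase m l" "Scatter m l"]
    by (simp add: source_value_def[abs_def])
  note R = rician_moments[OF ind _ uniform_phase_mean[OF phase_uniform] scatter_gaussian beta_pos, of "hbar S m l"]
  show "has_bochner_integral (pspace S) (\<lambda>\<omega>. chan S l \<omega> $ m) 0"
    "has_bochner_integral (pspace S) (\<lambda>\<omega>. chan S l \<omega> $ m * cnj (chan S l \<omega> $ m)) (of_real (beta' S m l))"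
    "has_bochner_integral (pspace S)
      (\<lambda>\<omega>. (chan S l \<omega> $ m * cnj (chan S l \<omega> $ m)) * cnj (chan S l \<omega> $ m * cnj (chan S l \<omega> $ m)))
      (of_real ((hbar S m l)^4 + 4 * (hbar S m l)\<^sup>2 * beta S m l + 2 * (beta S m l)\<^sup>2))"
    using R by (simp_all only: chan_def vec_lambda_beta beta'_def norm_cis simp_thms)
qed

text \<open>Despreading scales the variance of the white noise by the squared pilot norm, which is
  \<open>tau_p\<close>.\<close>

lemma noise_moments:
  shows "has_bochner_integral (pspace S) (\<lambda>\<omega>. hdot (pilot_seq S t) (noise S m \<omega>)) 0"
    and "has_bochner_integral (pspace S)
      (\<lambda>\<omega>. hdot (pilot_seq S t) (noise S m \<omega>) * cnj (hdot (pilot_seq S t) (noise S m \<omega>)))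
      (of_real (real (tau_p S) * sigma2 S))"
proof -
  have ind: "indep_vars (\<lambda>_. borel) (\<lambda>i \<omega>. noise S m \<omega> $ i) UNIV"
    and g: "cscg (pspace S) (\<lambda>\<omega>. noise S m \<omega> $ i) (sigma2 S)" for i
    using noise_gaussian[of m] by (auto simp: cscg_vec_def)
  note L = centered_linear_combination[OF ind cscg_moments(1)[OF g sigma2_pos] cscg_moments(3)[OF g sigma2_pos],
      of "\<lambda>i. cnj (pilot_seq S t $ i)"]
  have "(\<Sum>i\<in>UNIV. (cmod (cnj (pilot_seq S t $ i)))\<^sup>2 * sigma2 S) = (norm (pilot_seq S t))\<^sup>2 * sigma2 S"
    by (simp add: norm_vec_def L2_set_def sum_nonneg sum_distrib_right)
  then have e: "(\<Sum>i\<in>UNIV. (cmod (cnj (pilot_seq S t $ i)))\<^sup>2 * sigma2 S) = real (tau_p S) * sigma2 S"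
    by (simp only: pilots_norm)
  show "has_bochner_integral (pspace S) (\<lambda>\<omega>. hdot (pilot_seq S t) (noise S m \<omega>)) 0"
    using L(1) by (simp only: hdot_def)
  show "has_bochner_integral (pspace S)
      (\<lambda>\<omega>. hdot (pilot_seq S t) (noise S m \<omega>) * cnj (hdot (pilot_seq S t) (noise S m \<omega>)))
      (of_real (real (tau_p S) * sigma2 S))"
    using L(2) unfolding e by (simp only: hdot_def)
qed

text \<open>Adding the variances of all summands except user \<open>l\<close> leaves the total mean
  power from \<open>tau_lambda'\<close> minus the share of that user.\<close>

lemma interference_moments:
  shows "has_bochner_integral (pspace S) (interference S k l m) 0"
    and "has_bochner_integral (pspace S) (\<lambda>\<omega>. interference S k l m \<omega> * cnj (interference S k l m \<omega>))
      (of_real (real (tau_p S) * lambda' S m k - (coef S k l)\<^sup>2 * beta' S m l))"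
proof -
  have ind: "indep_vars (\<lambda>_. borel) (\<lambda>z. link S k (m, z)) UNIV"
    by (rule indep_vars_group[OF indep_link[of k], of "\<lambda>z. {(m, z)}" _ "\<lambda>z f. f (m, z)"])
       (auto simp: disjoint_family_on_def)
  define v where "v z = (case z of None \<Rightarrow> real (tau_p S) * sigma2 S | Some l' \<Rightarrow> beta' S m l')" for z
  let ?c = "\<lambda>z. if z = Some l then 0 else case z of None \<Rightarrow> 1 | Some l' \<Rightarrow> coef S k l'"
  have m1: "has_bochner_integral (pspace S) (\<lambda>\<omega>. link S k (m, z) \<omega>) 0" for z
    using chan_moments(1) noise_moments(1) by (cases z) (simp_all add: link_def)
  have m2: "has_bochner_integral (pspace S) (\<lambda>\<omega>. link S k (m, z) \<omega> * cnj (link S k (m, z) \<omega>)) (of_real (v z))" for z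
    using chan_moments(2) noise_moments(2) by (cases z) (simp_all add: link_def v_def)
  note L = centered_linear_combination[OF ind m1 m2, of "\<lambda>z. of_real (?c z)"]
  have "(\<Sum>z\<in>UNIV. (cmod (of_real (?c z)))\<^sup>2 * v z)
      = real (tau_p S) * sigma2 S + (\<Sum>i\<in>UNIV. if i = l then 0 else (coef S k i)\<^sup>2 * beta' S m i)"
    unfolding sum_UNIV_option
    by (intro arg_cong2[where f="(+)"] sum.cong) (auto simp: v_def)
  also have "\<dots> = real (tau_p S) * lambda' S m k - (coef S k l)\<^sup>2 * beta' S m l"
    by (simp add: tau_lambda' sum.remove[of UNIV l])
  finally have e: "(\<Sum>z\<in>UNIV. (cmod (of_real (?c z)))\<^sup>2 * v z)
    = real (tau_p S) * lambda' S m k - (coef S k l)\<^sup>2 * beta' S m l" .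
  show "has_bochner_integral (pspace S) (interference S k l m) 0"
    using L(1) by (simp only: interference_def[abs_def])
  show "has_bochner_integral (pspace S) (\<lambda>\<omega>. interference S k l m \<omega> * cnj (interference S k l m \<omega>))
      (of_real (real (tau_p S) * lambda' S m k - (coef S k l)\<^sup>2 * beta' S m l))"
    using L(2) unfolding e by (simp only: interference_def[abs_def])
qed

lemma indep_chan_interference:
  "indep_var borel (\<lambda>\<omega>. chan S l \<omega> $ m) borel (interference S k l m)"
proof (rule indep_var_group[OF indep_link[of k], of "{(m, Some l)}" "{m} \<times> (UNIV - {Some l})"
      "\<lambda>f. f (m, Some l)" _ "\<lambda>f. \<Sum>z\<in>UNIV - {Some l}. of_real (case z of None \<Rightarrow> 1 | Some l' \<Rightarrow> coef S k l') * f (m, z)"])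
  show "(\<lambda>f. \<Sum>z\<in>UNIV - {Some l}. complex_of_real (case z of None \<Rightarrow> 1 | Some l' \<Rightarrow> coef S k l') * f (m, z))
    \<in> borel_measurable (PiM ({m} \<times> (UNIV - {Some l})) (\<lambda>_. borel))"
    by (intro borel_measurable_sum borel_measurable_times measurable_const measurable_component_singleton) auto
  show "interference S k l m \<omega> = (\<Sum>z\<in>UNIV - {Some l}. complex_of_real (case z of None \<Rightarrow> 1 | Some l' \<Rightarrow> coef S k l')
     * (restrict (\<lambda>i. link S k i \<omega>) ({m} \<times> (UNIV - {Some l}))) (m, z))" for \<omega>
    unfolding interference_def by (rule sum.mono_neutral_cong_right) auto
qed (auto simp: link_def)

text \<open>The weights \<open>x\<close> will be \<open>cnj (a $ m) * w m\<close>. The summands are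
  independent over APs, since \<open>W m\<close> uses only the links of AP \<open>m\<close>, and
  \<open>second_moment_sum_indep\<close> combines their first and second moments.\<close>

lemma obs_chan_moments:
  fixes x :: "'m \<Rightarrow> complex"
  shows "has_bochner_integral (pspace S) (\<lambda>\<omega>. \<Sum>m\<in>UNIV. x m * (cnj (pilot_obs S k \<omega> $ m) * chan S l \<omega> $ m))
      (\<Sum>m\<in>UNIV. x m * of_real (coef S k l * beta' S m l))"
    and "has_bochner_integral (pspace S)
      (\<lambda>\<omega>. (cmod (\<Sum>m\<in>UNIV. x m * (cnj (pilot_obs S k \<omega> $ m) * chan S l \<omega> $ m)))\<^sup>2)
      ((cmod (\<Sum>m\<in>UNIV. x m * of_real (coef S k l * beta' S m l)))\<^sup>2
       + (\<Sum>m\<in>UNIV. (cmod (x m))\<^sup>2 * (real (tau_p S) * lambda' S m k * beta' S m l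
           + (coef S k l)\<^sup>2 * ((beta S m l)\<^sup>2 + 2 * (hbar S m l)\<^sup>2 * beta S m l - (beta' S m l)\<^sup>2))))"
proof -
  let ?b = "\<lambda>m. beta' S m l" and ?c = "coef S k l"
  define q where "q m = (hbar S m l)^4 + 4 * (hbar S m l)\<^sup>2 * beta S m l + 2 * (beta S m l)\<^sup>2" for m
  define s where "s m = real (tau_p S) * lambda' S m k - (coef S k l)\<^sup>2 * beta' S m l" for m
  define W where "W m \<omega> = x m * (cnj (pilot_obs S k \<omega> $ m) * chan S l \<omega> $ m)" for m \<omega>
  have Weq: "W m \<omega> = x m * (cnj (of_real ?c * chan S l \<omega> $ m + interference S k l m \<omega>) * chan S l \<omega> $ m)" for m \<omega>
    unfolding W_def pilot_obs_split[of S k \<omega> m l] ..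
  note CP = conjugate_product_moments[OF indep_chan_interference chan_moments(2,3)
      interference_moments chan_moments(1), where c="?c"]
  have W1: "has_bochner_integral (pspace S) (W m) (x m * of_real (?c * ?b m))" for m
    unfolding Weq[abs_def] by (rule has_bochner_integral_mult_right[OF CP(1)])
  have W2: "has_bochner_integral (pspace S) (\<lambda>\<omega>. W m \<omega> * cnj (W m \<omega>))
      (of_real ((cmod (x m))\<^sup>2 * (?c\<^sup>2 * q m + s m * ?b m)))" for m
  proof (rule has_bochner_integral_eqI[OF has_bochner_integral_mult_right[OF CP(2), of "x m * cnj (x m)"]])
    show "complex_of_real ((cmod (x m))\<^sup>2 * (?c\<^sup>2 * q m + s m * ?b m))
      = x m * cnj (x m) * complex_of_real (?c\<^sup>2 * (hbar S m l ^ 4 + 4 * (hbar S m l)\<^sup>2 * beta S m l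
          + 2 * (beta S m l)\<^sup>2) + (real (tau_p S) * lambda' S m k - ?c\<^sup>2 * ?b m) * ?b m)"
      by (simp only: of_real_mult complex_norm_square q_def s_def)
  qed (simp only: Weq complex_cnj_mult mult_ac)
  have ind: "indep_vars (\<lambda>_. borel) W UNIV"
  proof (rule indep_vars_group[OF indep_link[of k], of "\<lambda>m. {m} \<times> UNIV" _
        "\<lambda>m f. x m * (cnj (of_real ?c * f (m, Some l) + (\<Sum>z\<in>UNIV.
           of_real (if z = Some l then 0 else case z of None \<Rightarrow> 1 | Some l' \<Rightarrow> coef S k l') * f (m, z))) * f (m, Some l))"])
    fix m :: 'm
    have [measurable]: "(\<lambda>f. f (m, z)) \<in> borel_measurable (PiM ({m} \<times> UNIV) (\<lambda>_. borel))" for z :: "'k option"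
      by (rule measurable_component_singleton) auto
    show "(\<lambda>f. x m * (cnj (of_real ?c * f (m, Some l) + (\<Sum>z\<in>UNIV.
           of_real (if z = Some l then 0 else case z of None \<Rightarrow> 1 | Some l' \<Rightarrow> coef S k l') * f (m, z))) * f (m, Some l)))
       \<in> borel_measurable (PiM ({m} \<times> UNIV) (\<lambda>_. borel))"
      by (intro borel_measurable_times measurable_const measurable_compose[OF _ borel_measurable_cnj_id]
          borel_measurable_add borel_measurable_sum) measurable
  qed (auto simp: disjoint_family_on_def Weq interference_def link_def)
  show "has_bochner_integral (pspace S) (\<lambda>\<omega>. \<Sum>m\<in>UNIV. x m * (cnj (pilot_obs S k \<omega> $ m) * chan S l \<omega> $ m))
      (\<Sum>m\<in>UNIV. x m * of_real (coef S k l * beta' S m l))"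
    unfolding W_def[symmetric] by (intro has_bochner_integral_sum W1)
  have e: "(cmod (\<Sum>m\<in>UNIV. x m * of_real (?c * ?b m)))\<^sup>2 - (\<Sum>m\<in>UNIV. (cmod (x m * of_real (?c * ?b m)))\<^sup>2)
      + (\<Sum>m\<in>UNIV. (cmod (x m))\<^sup>2 * (?c\<^sup>2 * q m + s m * ?b m))
    = (cmod (\<Sum>m\<in>UNIV. x m * of_real (coef S k l * beta' S m l)))\<^sup>2
       + (\<Sum>m\<in>UNIV. (cmod (x m))\<^sup>2 * (real (tau_p S) * lambda' S m k * beta' S m l
           + (coef S k l)\<^sup>2 * ((beta S m l)\<^sup>2 + 2 * (hbar S m l)\<^sup>2 * beta S m l - (beta' S m l)\<^sup>2)))"
  proof -
    \<comment> \<open>Both sides agree because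
      \<open>q - 2 beta'^2 = - hbar^4 = beta^2 + 2 hbar^2 beta - beta'^2\<close>. One
      \<open>beta'^2\<close> comes from the squared mean, the other from the share of user
      \<open>l\<close> subtracted in \<open>s\<close>.\<close>
    have "(cmod (x m))\<^sup>2 * (?c\<^sup>2 * q m + s m * ?b m) - (cmod (x m * of_real (?c * ?b m)))\<^sup>2
      = (cmod (x m))\<^sup>2 * (real (tau_p S) * lambda' S m k * beta' S m l
           + (coef S k l)\<^sup>2 * ((beta S m l)\<^sup>2 + 2 * (hbar S m l)\<^sup>2 * beta S m l - (beta' S m l)\<^sup>2))" for m
      unfolding norm_mult norm_of_real power_mult_distrib power2_abs q_def s_def beta'_def
      by algebra
    then show ?thesis by (simp add: sum_subtractf[symmetric])
  qed
  show "has_bochner_integral (pspace S)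
      (\<lambda>\<omega>. (cmod (\<Sum>m\<in>UNIV. x m * (cnj (pilot_obs S k \<omega> $ m) * chan S l \<omega> $ m)))\<^sup>2)
      ((cmod (\<Sum>m\<in>UNIV. x m * of_real (coef S k l * beta' S m l)))\<^sup>2
       + (\<Sum>m\<in>UNIV. (cmod (x m))\<^sup>2 * (real (tau_p S) * lambda' S m k * beta' S m l
           + (coef S k l)\<^sup>2 * ((beta S m l)\<^sup>2 + 2 * (hbar S m l)\<^sup>2 * beta S m l - (beta' S m l)\<^sup>2))))"
    using has_bochner_integral_Re[OF second_moment_sum_indep[OF ind W1 W2]]
    unfolding complex_norm_square[symmetric] Re_complex_of_real e W_def .
qed

text \<open>Split at user \<open>k\<close> itself: the cross terms have mean zero, and the power
  missing in \<open>interference_moments\<close> is restored by the channel term.\<close>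

lemma obs_second_moment:
  "has_bochner_integral (pspace S) (\<lambda>\<omega>. (cmod (pilot_obs S k \<omega> $ m))\<^sup>2) (real (tau_p S) * lambda' S m k)"
proof -
  let ?U = "\<lambda>\<omega>. chan S k \<omega> $ m" and ?V = "interference S k k m" and ?c = "complex_of_real (coef S k k)"
  have UV: "has_bochner_integral (pspace S) (\<lambda>\<omega>. ?U \<omega> * cnj (?V \<omega>)) (0 * 0)"
    by (rule has_bochner_integral_indep_mult[OF indep_chan_interference, where f="\<lambda>x. x" and g=cnj])
       (use chan_moments(1) has_bochner_integral_cnj[OF interference_moments(1)] in auto)
  have "has_bochner_integral (pspace S) (\<lambda>\<omega>. pilot_obs S k \<omega> $ m * cnj (pilot_obs S k \<omega> $ m))
      (of_real (real (tau_p S) * lambda' S m k))"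
    by (rule has_bochner_integral_eqI[OF has_bochner_integral_add[OF has_bochner_integral_add[OF
          has_bochner_integral_mult_right[OF chan_moments(2)[of k m], of "?c * ?c"] interference_moments(2)[of k k m]]
          has_bochner_integral_add[OF has_bochner_integral_mult_right[OF UV, of ?c]
          has_bochner_integral_mult_right[OF has_bochner_integral_cnj[OF UV], of ?c]]]])
       (auto simp: pilot_obs_split[of S k _ m k] algebra_simps power2_eq_square)
  then show ?thesis
    using has_bochner_integral_Re unfolding complex_norm_square[symmetric] by fastforce
qed

end

section \<open>The SINR as a Rayleigh quotient\<close>

text \<open>Per AP, the mean of \<open>w m * cnj y * h\<close>, so that
  \<open>hdot a (gain S k w l)\<close> is the mean combined channel of user \<open>l\<close>. It is
  zero for users on other pilots.\<close>

definition gain ::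
    "('w, 'm::finite, 'k, 't::finite) cf_system \<Rightarrow> 'k \<Rightarrow> ('m \<Rightarrow> real) \<Rightarrow> 'k \<Rightarrow> complex ^ 'm" where
  "gain S k w l = (\<chi> m. of_real (w m * (coef S k l * beta' S m l)))"

text \<open>The diagonal part of the SINR denominator: per-AP variances plus amplified noise. The
  bracket \<open>beta^2 + 2 hbar^2 beta - beta'^2\<close> equals \<open>- hbar^4\<close> and is kept
  in the shape of \<open>R^2 + 2 L R - R'^2\<close>.\<close>

definition load ::
    "('w, 'm::finite, 'k::finite, 't::finite) cf_system \<Rightarrow> 'k \<Rightarrow> ('m \<Rightarrow> real) \<Rightarrow> 'm \<Rightarrow> real" where
  "load S k w m = (w m)\<^sup>2 *
     ((\<Sum>l\<in>UNIV. data_pow S l * (real (tau_p S) * lambda' S m k * beta' S m l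
        + (coef S k l)\<^sup>2 * ((beta S m l)\<^sup>2 + 2 * (hbar S m l)\<^sup>2 * beta S m l - (beta' S m l)\<^sup>2)))
      + sigma2 S * (real (tau_p S) * lambda' S m k))"

text \<open>The common shape of both \<open>\<Gamma>\<close> matrices, for combining with \<open>w\<^sub>m y\<^sub>m\<close>: the term \<open>l = k\<close> of the
  rank-one part cancels against \<open>- p\<^sub>k b\<^sub>k b\<^sub>k\<^sup>H\<close>.\<close>

definition Gam_scaled ::
    "('w, 'm::finite, 'k::finite, 't::finite) cf_system \<Rightarrow> 'k \<Rightarrow> ('m \<Rightarrow> real) \<Rightarrow> complex ^ 'm ^ 'm" where
  "Gam_scaled S k w = diag_mat (\<chi> m. of_real (load S k w m))
     + (\<Sum>l\<in>UNIV - {k}. data_pow S l *\<^sub>R houter (gain S k w l) (gain S k w l))"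

definition scaled_obs ::
    "('w, 'm::finite, 'k, 't::finite) cf_system \<Rightarrow> 'k \<Rightarrow> ('m \<Rightarrow> real) \<Rightarrow> 'w \<Rightarrow> complex ^ 'm" where
  "scaled_obs S k w \<omega> = (\<chi> m. of_real (w m) * pilot_obs S k \<omega> $ m)"

lemma form_Gam_scaled:
  "hdot u (Gam_scaled S k w *v v) = (\<Sum>m\<in>UNIV. cnj (u $ m) * of_real (load S k w m) * v $ m)
     + (\<Sum>l\<in>UNIV - {k}. of_real (data_pow S l) * (hdot u (gain S k w l) * hdot (gain S k w l) v))"
  by (simp add: Gam_scaled_def hdot_form_add hdot_form_sum hdot_form_scaleR hdot_form_houter hdot_form_diag)

lemma Re_form_Gam_scaled:
  "Re (hdot a (Gam_scaled S k w *v a)) = (\<Sum>m\<in>UNIV. (cmod (a $ m))\<^sup>2 * load S k w m)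
     + (\<Sum>l\<in>UNIV - {k}. data_pow S l * (cmod (hdot a (gain S k w l)))\<^sup>2)"
proof -
  have "hdot a (gain S k w l) * hdot (gain S k w l) a = of_real ((cmod (hdot a (gain S k w l)))\<^sup>2)" for l
    unfolding complex_norm_square cnj_hdot ..
  moreover have "cnj (a $ m) * of_real (load S k w m) * a $ m = of_real ((cmod (a $ m))\<^sup>2 * load S k w m)" for m
    unfolding of_real_mult complex_norm_square by (simp only: mult_ac)
  ultimately have "hdot a (Gam_scaled S k w *v a) = of_real ((\<Sum>m\<in>UNIV. (cmod (a $ m))\<^sup>2 * load S k w m)
     + (\<Sum>l\<in>UNIV - {k}. data_pow S l * (cmod (hdot a (gain S k w l)))\<^sup>2))"
    unfolding form_Gam_scaled by (simp only: of_real_add of_real_sum of_real_mult)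
  then show ?thesis by simp
qed

lemma load_scale: "load S k w m = (w m)\<^sup>2 * load S k (\<lambda>_. 1) m"
  by (simp add: load_def)

lemma hdot_gain: "hdot u (gain S k w l) = hdot (\<chi> m. of_real (w m) * u $ m) (gain S k (\<lambda>_. 1) l)"
  by (simp add: hdot_def gain_def ac_simps)

context cell_free
begin

text \<open>The only negative term, \<open>- (coef * beta')^2\<close>, is absorbed by
  \<open>coef_beta'_le\<close> multiplied with \<open>beta'\<close>. The noise gives strict
  positivity even when all data powers vanish.\<close>

lemma load_pos:
  assumes "w m \<noteq> 0"
  shows "0 < load S k w m"
proof -
  have "0 \<le> data_pow S l * (real (tau_p S) * lambda' S m k * beta' S m l
        + (coef S k l)\<^sup>2 * ((beta S m l)\<^sup>2 + 2 * (hbar S m l)\<^sup>2 * beta S m l - (beta' S m l)\<^sup>2))" for l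
  proof (rule mult_nonneg_nonneg[OF data_pow_nonneg])
    have "(coef S k l)\<^sup>2 * beta' S m l * beta' S m l \<le> real (tau_p S) * lambda' S m k * beta' S m l"
      by (rule mult_right_mono[OF coef_beta'_le less_imp_le[OF beta'_pos]])
    moreover have "0 \<le> (coef S k l)\<^sup>2 * ((beta S m l)\<^sup>2 + 2 * (hbar S m l)\<^sup>2 * beta S m l)"
      using beta_pos[of m l] by simp
    ultimately show "0 \<le> real (tau_p S) * lambda' S m k * beta' S m l
        + (coef S k l)\<^sup>2 * ((beta S m l)\<^sup>2 + 2 * (hbar S m l)\<^sup>2 * beta S m l - (beta' S m l)\<^sup>2)"
      by (simp add: algebra_simps power2_eq_square)
  qed
  moreover have "0 < sigma2 S * (real (tau_p S) * lambda' S m k)"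
    using sigma2_pos tau_p_pos lambda'_pos by simp
  ultimately show ?thesis
    unfolding load_def using assms by (intro mult_pos_pos[of "(w m)\<^sup>2"] add_nonneg_pos sum_nonneg) auto
qed

text \<open>A positive diagonal plus nonnegative multiples of squared moduli; with the term of user
  \<open>k\<close> already cancelled, no negative rank-one part is left.\<close>

lemma Gam_scaled_pd:
  assumes w: "\<And>m. w m \<noteq> 0"
  shows "hermitian_pd (Gam_scaled S k w)"
proof
  show "cnj (hdot u (Gam_scaled S k w *v v)) = hdot v (Gam_scaled S k w *v u)" for u v
    unfolding form_Gam_scaled by (simp add: cnj_hdot ac_simps)
  fix a :: "complex ^ 'm" assume "a \<noteq> 0"
  then obtain m where m: "a $ m \<noteq> 0" by (auto simp: vec_eq_iff)
  have "0 < (\<Sum>m\<in>UNIV. (cmod (a $ m))\<^sup>2 * load S k w m)"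
    using m load_pos[OF w] by (intro sum_pos2[of _ m]) (auto intro!: mult_nonneg_nonneg less_imp_le[OF load_pos] w)
  moreover have "0 \<le> (\<Sum>l\<in>UNIV - {k}. data_pow S l * (cmod (hdot a (gain S k w l)))\<^sup>2)"
    by (intro sum_nonneg mult_nonneg_nonneg data_pow_nonneg) auto
  ultimately show "0 < Re (hdot a (Gam_scaled S k w *v a))"
    unfolding Re_form_Gam_scaled by simp
qed

lemma gain_self_nonzero:
  assumes w: "\<And>m. w m \<noteq> 0"
  shows "gain S k w k \<noteq> 0"
proof -
  have "coef S k k \<noteq> 0" using coef_pos[of k k] by (simp add: copilot_def)
  moreover have "beta' S m k \<noteq> 0" for m using beta'_pos[of m k] by simp
  ultimately show ?thesis using w by (simp add: gain_def vec_eq_iff)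
qed

lemma comb_scaled_obs:
  "comb S (scaled_obs S k w) a l \<omega>
     = (\<Sum>m\<in>UNIV. (cnj (a $ m) * of_real (w m)) * (cnj (pilot_obs S k \<omega> $ m) * chan S l \<omega> $ m))"
  by (simp add: comb_def scaled_obs_def hdot_def hadj_diag_mat diag_mat_mult_vec ac_simps)

lemma hdot_gain_sum:
  "(\<Sum>m\<in>UNIV. (cnj (a $ m) * of_real (w m)) * of_real (coef S k l * beta' S m l)) = hdot a (gain S k w l)"
  by (simp add: hdot_def gain_def ac_simps)

text \<open>The denominator matches the quadratic form piece by piece: the squared mean at
  \<open>l = k\<close> cancels the subtracted signal power, the other squared means are the rank-one
  terms, and variances and noise collect to \<open>load\<close>.\<close>

lemma sinr_scaled_obs:
  "sinr_ul S (scaled_obs S k w) k a =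
     data_pow S k * ((cmod (hdot a (gain S k w k)))\<^sup>2 / Re (hdot a (Gam_scaled S k w *v a)))"
proof -
  let ?A = "\<lambda>m l. real (tau_p S) * lambda' S m k * beta' S m l
           + (coef S k l)\<^sup>2 * ((beta S m l)\<^sup>2 + 2 * (hbar S m l)\<^sup>2 * beta S m l - (beta' S m l)\<^sup>2)"
  let ?g = "\<lambda>l. (cmod (hdot a (gain S k w l)))\<^sup>2"
  let ?x = "\<lambda>m. (cmod (a $ m))\<^sup>2 * (w m)\<^sup>2"
  note M = obs_chan_moments[of "\<lambda>m. cnj (a $ m) * of_real (w m)" k,
      folded comb_scaled_obs, unfolded hdot_gain_sum]
  have mean: "integral\<^sup>L (pspace S) (comb S (scaled_obs S k w) a l) = hdot a (gain S k w l)" for l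
    using has_bochner_integral_integral_eq[OF M(1)] .
  have sq: "integral\<^sup>L (pspace S) (\<lambda>\<omega>. (cmod (comb S (scaled_obs S k w) a l \<omega>))\<^sup>2)
     = ?g l + (\<Sum>m\<in>UNIV. ?x m * ?A m l)" for l
    using has_bochner_integral_integral_eq[OF M(2)] by (simp add: norm_mult power_mult_distrib)
  have "has_bochner_integral (pspace S) (\<lambda>\<omega>. (norm (diag_mat a *v scaled_obs S k w \<omega>))\<^sup>2)
     (\<Sum>m\<in>UNIV. ?x m * (real (tau_p S) * lambda' S m k))"
  proof (rule has_bochner_integral_eqI[OF has_bochner_integral_sum[OF has_bochner_integral_mult_right[OF obs_second_moment]]])
    show "(norm (diag_mat a *v scaled_obs S k w \<omega>))\<^sup>2 = (\<Sum>m\<in>UNIV. ?x m * (cmod (pilot_obs S k \<omega> $ m))\<^sup>2)" for \<omega>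
      by (simp add: norm_diag_mat_mult_square scaled_obs_def norm_mult power_mult_distrib ac_simps)
  qed simp
  note nrm = has_bochner_integral_integral_eq[OF this]
  have "(\<Sum>l\<in>UNIV. data_pow S l * (?g l + (\<Sum>m\<in>UNIV. ?x m * ?A m l)))
      = (\<Sum>l\<in>UNIV. data_pow S l * ?g l) + (\<Sum>l\<in>UNIV. data_pow S l * (\<Sum>m\<in>UNIV. ?x m * ?A m l))"
    by (simp only: distrib_left sum.distrib)
  moreover have "(\<Sum>l\<in>UNIV. data_pow S l * ?g l) = data_pow S k * ?g k + (\<Sum>l\<in>UNIV - {k}. data_pow S l * ?g l)"
    by (rule sum.remove) auto
  moreover have "sigma2 S * (\<Sum>m\<in>UNIV. ?x m * (real (tau_p S) * lambda' S m k))
      = (\<Sum>m\<in>UNIV. ?x m * (sigma2 S * (real (tau_p S) * lambda' S m k)))"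
    unfolding sum_distrib_left by (rule sum.cong) (simp_all only: mult.left_commute)
  ultimately have "(\<Sum>l\<in>UNIV. data_pow S l * (?g l + (\<Sum>m\<in>UNIV. ?x m * ?A m l)))
      - data_pow S k * ?g k + sigma2 S * (\<Sum>m\<in>UNIV. ?x m * (real (tau_p S) * lambda' S m k))
    = (\<Sum>l\<in>UNIV. data_pow S l * (\<Sum>m\<in>UNIV. ?x m * ?A m l))
      + (\<Sum>m\<in>UNIV. ?x m * (sigma2 S * (real (tau_p S) * lambda' S m k)))
      + (\<Sum>l\<in>UNIV - {k}. data_pow S l * ?g l)"
    by linarith
  also have "(\<Sum>l\<in>UNIV. data_pow S l * (\<Sum>m\<in>UNIV. ?x m * ?A m l))
      = (\<Sum>m\<in>UNIV. ?x m * (\<Sum>l\<in>UNIV. data_pow S l * ?A m l))"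
    unfolding sum_distrib_left by (subst sum.swap) (simp only: mult.left_commute)
  also have "\<dots> + (\<Sum>m\<in>UNIV. ?x m * (sigma2 S * (real (tau_p S) * lambda' S m k)))
     = (\<Sum>m\<in>UNIV. (cmod (a $ m))\<^sup>2 * load S k w m)"
    unfolding load_def sum.distrib[symmetric] distrib_left[symmetric] by (simp only: mult.assoc)
  finally show ?thesis
    unfolding sinr_ul_def mean sq nrm Re_form_Gam_scaled by simp
qed

lemma SE_scaled_obs_le:
  assumes w: "\<And>m. w m \<noteq> 0"
  shows "SE_ul S (scaled_obs S k w) k a
    \<le> rate S (data_pow S k * Re (hdot (gain S k w k) (matrix_inv (Gam_scaled S k w) *v gain S k w k)))"
proof -
  interpret hermitian_pd "Gam_scaled S k w" by (rule Gam_scaled_pd[OF w])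
  have "0 \<le> Re (hdot a (Gam_scaled S k w *v a))"
    using positive[of a] by (cases "a = 0") auto
  \<comment> \<open>Nonnegativity keeps the argument \<open>1 + SINR\<close> of the logarithm
    positive, where it is monotone.\<close>
  then have "0 \<le> sinr_ul S (scaled_obs S k w) k a"
    unfolding sinr_scaled_obs using data_pow_nonneg by simp
  moreover have "sinr_ul S (scaled_obs S k w) k a
     \<le> data_pow S k * Re (hdot (gain S k w k) (matrix_inv (Gam_scaled S k w) *v gain S k w k))"
    unfolding sinr_scaled_obs by (rule mult_left_mono[OF rayleigh_le data_pow_nonneg])
  ultimately show ?thesis
    unfolding SE_ul_def rate_def by (intro mult_left_mono) auto
qed

lemma SE_scaled_obs_eq:
  assumes w: "\<And>m. w m \<noteq> 0"
  shows "SE_ul S (scaled_obs S k w) k (matrix_inv (Gam_scaled S k w) *v gain S k w k)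
    = rate S (data_pow S k * Re (hdot (gain S k w k) (matrix_inv (Gam_scaled S k w) *v gain S k w k)))"
proof -
  interpret hermitian_pd "Gam_scaled S k w" by (rule Gam_scaled_pd[OF w])
  show ?thesis
    unfolding SE_ul_def sinr_scaled_obs rayleigh_eq[OF gain_self_nonzero[OF w]] ..
qed

text \<open>The map \<open>?D\<close> absorbs the weights into the LSFD vector: the form of
  \<open>Gam_scaled S k w\<close> at \<open>u\<close>, \<open>v\<close> is the unit-weight form at
  \<open>?D u\<close>, \<open>?D v\<close>, and the gain transforms likewise. Hence
  \<open>?D x\<close> solves the unit-weight linear system.\<close>

lemma optimal_value_scale_invariant:
  assumes w: "\<And>m. w m \<noteq> 0"
  shows "hdot (gain S k w k) (matrix_inv (Gam_scaled S k w) *v gain S k w k)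
    = hdot (gain S k (\<lambda>_. 1) k) (matrix_inv (Gam_scaled S k (\<lambda>_. 1)) *v gain S k (\<lambda>_. 1) k)"
proof -
  interpret W: hermitian_pd "Gam_scaled S k w" by (rule Gam_scaled_pd[OF w])
  interpret I: hermitian_pd "Gam_scaled S k (\<lambda>_. 1)" by (rule Gam_scaled_pd) simp
  define x where "x = matrix_inv (Gam_scaled S k w) *v gain S k w k"
  let ?D = "\<lambda>u. (\<chi> m. of_real (w m) * u $ m) :: complex ^ 'm"
  have form: "hdot (?D u) (Gam_scaled S k (\<lambda>_. 1) *v ?D v) = hdot u (Gam_scaled S k w *v v)" for u v
  proof -
    have "hdot (gain S k w l) v = hdot (gain S k (\<lambda>_. 1) l) (?D v)" for l
      using hdot_gain[of v S k w l] by (metis cnj_hdot)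
    then show ?thesis
      unfolding form_Gam_scaled load_scale[of S k w] hdot_gain[of u S k w]
      by (simp add: power2_eq_square ac_simps)
  qed
  have D: "hdot (?D u) (Gam_scaled S k (\<lambda>_. 1) *v ?D x) = hdot (?D u) (gain S k (\<lambda>_. 1) k)" for u
    unfolding form x_def W.mult_inv by (rule hdot_gain)
  have "Gam_scaled S k (\<lambda>_. 1) *v ?D x = gain S k (\<lambda>_. 1) k"
  proof (rule hdot_eqI)
    fix v :: "complex ^ 'm"
    \<comment> \<open>Nonzero weights make \<open>?D\<close> surjective, so the identity
      \<open>D\<close> holds against every test vector.\<close>
    have e: "?D (\<chi> m. v $ m / of_real (w m)) = v"
      using w by (simp add: vec_eq_iff)
    show "hdot v (Gam_scaled S k (\<lambda>_. 1) *v ?D x) = hdot v (gain S k (\<lambda>_. 1) k)"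
      using D[of "\<chi> m. v $ m / of_real (w m)"] unfolding e .
  qed
  then have "?D x = matrix_inv (Gam_scaled S k (\<lambda>_. 1)) *v gain S k (\<lambda>_. 1) k"
    by (rule I.inj[OF trans]) (simp add: I.mult_inv)
  moreover have "hdot (gain S k w k) x = hdot (gain S k (\<lambda>_. 1) k) (?D x)"
    using hdot_gain[of x S k w k] by (metis cnj_hdot)
  ultimately show ?thesis by (simp add: x_def)
qed

end

section \<open>The LS and LMMSE combiners\<close>

context cell_free
begin

text \<open>Undoes the cancellation at \<open>l = k\<close> and separates the copilot terms, giving
  the layout in which \<open>Gam_ls\<close> and \<open>Gam_lmmse\<close> are defined; both are then
  matched term by term.\<close>

lemma Gam_scaled_expand:
  "Gam_scaled S k w =
     (\<Sum>l\<in>UNIV. data_pow S l *\<^sub>R diag_mat (\<chi> m. of_real ((w m)\<^sup>2 * (real (tau_p S) * lambda' S m k * beta' S m l))))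
     + (\<Sum>l\<in>copilot S k. data_pow S l *\<^sub>R
         (diag_mat (\<chi> m. of_real ((w m)\<^sup>2 * ((coef S k l)\<^sup>2 *
            ((beta S m l)\<^sup>2 + 2 * (hbar S m l)\<^sup>2 * beta S m l - (beta' S m l)\<^sup>2))))
          + houter (gain S k w l) (gain S k w l)))
     - data_pow S k *\<^sub>R houter (gain S k w k) (gain S k w k)
     + diag_mat (\<chi> m. of_real ((w m)\<^sup>2 * (sigma2 S * (real (tau_p S) * lambda' S m k))))"
proof -
  let ?H = "\<lambda>l. data_pow S l *\<^sub>R houter (gain S k w l) (gain S k w l)"
  let ?e1 = "\<lambda>l m. (w m)\<^sup>2 * (real (tau_p S) * lambda' S m k * beta' S m l)"
  let ?e2 = "\<lambda>l m. (w m)\<^sup>2 * ((coef S k l)\<^sup>2 * ((beta S m l)\<^sup>2 + 2 * (hbar S m l)\<^sup>2 * beta S m l - (beta' S m l)\<^sup>2))"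
  let ?e3 = "\<lambda>m. (w m)\<^sup>2 * (sigma2 S * (real (tau_p S) * lambda' S m k))"
  have "(\<Sum>l\<in>copilot S k. data_pow S l *\<^sub>R (diag_mat (\<chi> m. of_real (?e2 l m)) + houter (gain S k w l) (gain S k w l)))
    = (\<Sum>l\<in>UNIV. data_pow S l *\<^sub>R diag_mat (\<chi> m. of_real (?e2 l m)) + ?H l)"
  \<comment> \<open>Outside the copilot set \<open>coef\<close> is 0, which kills the diagonal
    correction and the gain, so the sum extends to all users.\<close>
  proof (rule sum.mono_neutral_cong_left)
    show "\<forall>l\<in>UNIV - copilot S k. data_pow S l *\<^sub>R diag_mat (\<chi> m. of_real (?e2 l m)) + ?H l = 0"
    proof
      fix l assume "l \<in> UNIV - copilot S k"
      then have c: "coef S k l = 0" by (simp add: coef_def)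
      then have "gain S k w l = 0" by (simp add: gain_def vec_eq_iff)
      with c show "data_pow S l *\<^sub>R diag_mat (\<chi> m. of_real (?e2 l m)) + ?H l = 0"
        by (simp add: diag_mat_zero)
    qed
  qed (auto simp: scaleR_add_right)
  also have "\<dots> = diag_mat (\<chi> m. of_real (\<Sum>l\<in>UNIV. data_pow S l * ?e2 l m)) + (?H k + (\<Sum>l\<in>UNIV - {k}. ?H l))"
    unfolding sum.distrib diag_mat_sum_real by (subst sum.remove[of UNIV k ?H]) auto
  finally have 1: "(\<Sum>l\<in>copilot S k. data_pow S l *\<^sub>R (diag_mat (\<chi> m. of_real (?e2 l m)) + houter (gain S k w l) (gain S k w l)))
    = diag_mat (\<chi> m. of_real (\<Sum>l\<in>UNIV. data_pow S l * ?e2 l m)) + (?H k + (\<Sum>l\<in>UNIV - {k}. ?H l))" .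
  have "load S k w m = (\<Sum>l\<in>UNIV. data_pow S l * ?e1 l m) + (\<Sum>l\<in>UNIV. data_pow S l * ?e2 l m) + ?e3 m" for m
    unfolding load_def sum.distrib[symmetric] distrib_left sum_distrib_left
    by (simp only: mult.left_commute mult.assoc)
  then have 2: "diag_mat (\<chi> m. of_real (load S k w m))
     = diag_mat (\<chi> m. complex_of_real (\<Sum>l\<in>UNIV. data_pow S l * ?e1 l m))
       + diag_mat (\<chi> m. of_real (\<Sum>l\<in>UNIV. data_pow S l * ?e2 l m)) + diag_mat (\<chi> m. of_real (?e3 m))"
    by (simp add: diag_mat_add)
  show ?thesis
    unfolding Gam_scaled_def 1 2 diag_mat_sum_real by (simp add: algebra_simps)
qed

section \<open>Explicit entries of the LS and LMMSE matrices\<close>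

lemma lambda'_nz [simp]: "lambda' S m k \<noteq> 0"
  using lambda'_pos[of m k] by simp

lemma tau_p_nz [simp]: "tau_p S \<noteq> 0"
  using tau_p_pos by simp

lemma Rm'_diag: "Rm' S l = diag_mat (\<chi> m. of_real (beta' S m l))"
  by (simp add: Rm'_def Rm_def Lm_def diag_mat_add beta'_def)

lemma Lam'_diag: "Lam' S k = diag_mat (\<chi> m. of_real (1 / lambda' S m k))"
  unfolding Lam'_def by (subst matrix_inv_diag_mat) (auto simp: inverse_eq_divide)

lemma inv_Lam'_diag: "matrix_inv (Lam' S k) = diag_mat (\<chi> m. of_real (lambda' S m k))"
  unfolding Lam'_diag by (subst matrix_inv_diag_mat) auto

lemma Om'_diag: "Om' S k = diag_mat (\<chi> m. of_real ((beta' S m k)\<^sup>2 / lambda' S m k))"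
  by (simp add: Om'_def Rm'_diag Lam'_diag diag_mat_mult power2_eq_square)

lemma b_ls_eq: "b_ls S l = (\<chi> m. of_real (beta' S m l))"
  by (simp add: b_ls_def Rm'_diag)

abbreviation w_ls :: "'k \<Rightarrow> 'm \<Rightarrow> real" where
  "w_ls k \<equiv> \<lambda>_. 1 / (sqrt (pilot_pow S k) * real (tau_p S))"

abbreviation w_lmmse :: "'k \<Rightarrow> 'm \<Rightarrow> real" where
  "w_lmmse k \<equiv> \<lambda>m. sqrt (pilot_pow S k) * beta' S m k / lambda' S m k"

lemma pilot_pow_nz [simp]: "pilot_pow S k \<noteq> 0"
  using pilot_pow_pos[of k] by simp

lemma sqrt_pilot_pow_square [simp]: "(sqrt (pilot_pow S k))\<^sup>2 = pilot_pow S k"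
  using pilot_pow_pos[of k] by simp

lemma w_ls_nz: "w_ls k m \<noteq> 0"
  by simp

lemma w_lmmse_nz: "w_lmmse k m \<noteq> 0"
  using beta'_pos[of m k] by simp

lemma est_ls_scaled: "est_ls S k = scaled_obs S k (w_ls k)"
  by (simp add: fun_eq_iff est_ls_def scaled_obs_def)

lemma est_lmmse_scaled: "est_lmmse S k = scaled_obs S k (w_lmmse k)"
  by (simp add: fun_eq_iff est_lmmse_def scaled_obs_def)

lemma copilot_self: "k \<in> copilot S k"
  by (simp add: copilot_def)

text \<open>The factor squares to \<open>pilot_pow S l / pilot_pow S k\<close>, the prefactor of
  \<open>Gam_ls2\<close>, and is 1 for \<open>l = k\<close>.\<close>

lemma gain_ls:
  "l \<in> copilot S k \<Longrightarrow> gain S k (w_ls k) l = (sqrt (pilot_pow S l) / sqrt (pilot_pow S k)) *\<^sub>R b_ls S l"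
  by (simp add: gain_def b_ls_eq coef_def vec_eq_iff scaleR_complex)

lemma b_ls_gain: "b_ls S k = gain S k (w_ls k) k"
  by (simp add: gain_ls copilot_self)

lemma d_vec_eq: "d_vec S k l = (\<chi> m. of_real (beta' S m l * beta' S m k / lambda' S m k))"
  by (simp add: d_vec_def Rm'_diag Lam'_diag diag_mat_mult)

text \<open>The factor squares to \<open>pilot_pow S k * pilot_pow S l * (real (tau_p S))^2\<close>,
  which with the data power is the prefactor of the copilot sum in \<open>Gam_lmmse\<close>.\<close>

lemma gain_lmmse:
  "l \<in> copilot S k \<Longrightarrow> gain S k (w_lmmse k) l
     = (sqrt (pilot_pow S k) * sqrt (pilot_pow S l) * real (tau_p S)) *\<^sub>R d_vec S k l"
  by (simp add: gain_def d_vec_eq coef_def vec_eq_iff scaleR_complex)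

lemma b_lmmse_gain: "b_lmmse S k = gain S k (w_lmmse k) k"
  using pilot_pow_pos[of k]
  by (simp add: gain_lmmse copilot_self b_lmmse_def Om'_diag d_vec_eq vec_eq_iff power2_eq_square[of "beta' _ _ _"])

lemma Gam_ls1_diag:
  "Gam_ls1 S k l = diag_mat (\<chi> m. of_real ((w_ls k m)\<^sup>2 * (real (tau_p S) * lambda' S m k * beta' S m l)))"
  by (simp add: Gam_ls1_def inv_Lam'_diag Rm'_diag diag_mat_mult diag_mat_scaleR scaleR_complex
      power_divide power_mult_distrib power2_eq_square[of "real (tau_p S)"] flip: of_real_mult of_real_power)

lemma Gam_ls2_eq:
  assumes "l \<in> copilot S k"
  shows "Gam_ls2 S k l =
    diag_mat (\<chi> m. of_real ((w_ls k m)\<^sup>2 * ((coef S k l)\<^sup>2 *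
            ((beta S m l)\<^sup>2 + 2 * (hbar S m l)\<^sup>2 * beta S m l - (beta' S m l)\<^sup>2))))
    + houter (gain S k (w_ls k) l) (gain S k (w_ls k) l)"
proof -
  have 1: "Rm S l ** Rm S l + 2 *\<^sub>R (Lm S l ** Rm S l) + houter (b_ls S l) (b_ls S l) - Rm' S l ** Rm' S l
    = diag_mat (\<chi> m. of_real ((beta S m l)\<^sup>2 + 2 * (hbar S m l)\<^sup>2 * beta S m l - (beta' S m l)\<^sup>2))
      + houter (b_ls S l) (b_ls S l)"
  proof -
    have "Rm S l ** Rm S l + 2 *\<^sub>R (Lm S l ** Rm S l) - Rm' S l ** Rm' S l
      = diag_mat (\<chi> m. of_real ((beta S m l)\<^sup>2 + 2 * (hbar S m l)\<^sup>2 * beta S m l - (beta' S m l)\<^sup>2))"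
      by (simp add: Rm_def Lm_def Rm'_diag diag_mat_mult diag_mat_add diag_mat_diff diag_mat_scaleR
          power2_eq_square scaleR_complex mult.assoc)
    then show ?thesis by (simp add: algebra_simps)
  qed
  \<comment> \<open>The pilot length cancels between \<open>w_ls^2 = 1 / (p_k tau_p^2)\<close> and
    \<open>coef^2 = p_l tau_p^2\<close>.\<close>
  have 2: "(w_ls k m)\<^sup>2 * ((coef S k l)\<^sup>2 * x) = pilot_pow S l / pilot_pow S k * x" for m x
    using assms by (simp add: coef_square power_divide power_mult_distrib)
  show ?thesis
    unfolding Gam_ls2_def 1 2 gain_ls[OF assms] houter_scaleR scaleR_add_right diag_mat_scaleR
    by (simp add: power_divide scaleR_complex)
qed

lemma Gam_ls_scaled: "Gam_ls S k = Gam_scaled S k (w_ls k)"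
proof -
  have 3: "(sigma2 S / (pilot_pow S k * real (tau_p S))) *\<^sub>R matrix_inv (Lam' S k)
    = diag_mat (\<chi> m. of_real ((w_ls k m)\<^sup>2 * (sigma2 S * (real (tau_p S) * lambda' S m k))))"
    by (simp add: inv_Lam'_diag diag_mat_scaleR scaleR_complex
      power_divide power_mult_distrib power2_eq_square[of "real (tau_p S)"] flip: of_real_mult of_real_power)
  show ?thesis
    unfolding Gam_scaled_expand Gam_ls_def Gam_ls1_diag 3 b_ls_gain
    \<comment> \<open>\<open>Gam_ls2_eq\<close> requires a copilot user; \<open>sum.cong\<close>
      supplies the membership of \<open>l\<close> under the sum.\<close>
    by (simp only: Gam_ls2_eq cong: sum.cong)
qed

lemma Gam_lmmse_scaled: "Gam_lmmse S k = Gam_scaled S k (w_lmmse k)"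
proof -
  have 1: "(data_pow S l * pilot_pow S k * real (tau_p S)) *\<^sub>R (Rm' S l ** Om' S k)
    = data_pow S l *\<^sub>R diag_mat (\<chi> m. of_real ((w_lmmse k m)\<^sup>2 * (real (tau_p S) * lambda' S m k * beta' S m l)))" for l
    by (simp add: Rm'_diag Om'_diag diag_mat_mult diag_mat_scaleR scaleR_complex ac_simps
      power_divide power_mult_distrib power2_eq_square[of "lambda' _ _ _"] flip: of_real_mult of_real_power of_real_divide)
  have 2: "(data_pow S l * pilot_pow S k * pilot_pow S l * (real (tau_p S))\<^sup>2) *\<^sub>R
          (Rm S l ** Rm S l ** Lam' S k ** Om' S k
           + 2 *\<^sub>R (Lam' S k ** Om' S k ** Lm S l ** Rm S l)
           + houter (d_vec S k l) (d_vec S k l)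
           - (Rm' S l ** Lam' S k ** Rm' S k) ** (Rm' S l ** Lam' S k ** Rm' S k))
     = data_pow S l *\<^sub>R
         (diag_mat (\<chi> m. of_real ((w_lmmse k m)\<^sup>2 * ((coef S k l)\<^sup>2 *
            ((beta S m l)\<^sup>2 + 2 * (hbar S m l)\<^sup>2 * beta S m l - (beta' S m l)\<^sup>2))))
          + houter (gain S k (w_lmmse k) l) (gain S k (w_lmmse k) l))"
    if l: "l \<in> copilot S k" for l
  proof -
    let ?c = "pilot_pow S k * pilot_pow S l * (real (tau_p S))\<^sup>2"
    \<comment> \<open>The three diagonal products share the factor
      \<open>(beta' S m k / lambda' S m k)^2\<close>: it is the entry of
      \<open>Lam' S k ** Om' S k\<close> in two of them and comes from squaring
      \<open>Rm' S l ** Lam' S k ** Rm' S k\<close> in the third.\<close>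
    let ?q = "\<lambda>m. ((beta S m l)\<^sup>2 + 2 * (hbar S m l)\<^sup>2 * beta S m l - (beta' S m l)\<^sup>2) * ((beta' S m k)\<^sup>2 / (lambda' S m k)\<^sup>2)"
    have a: "Rm S l ** Rm S l ** Lam' S k ** Om' S k
           + 2 *\<^sub>R (Lam' S k ** Om' S k ** Lm S l ** Rm S l)
           + houter (d_vec S k l) (d_vec S k l)
           - (Rm' S l ** Lam' S k ** Rm' S k) ** (Rm' S l ** Lam' S k ** Rm' S k)
        = diag_mat (\<chi> m. of_real (?q m)) + houter (d_vec S k l) (d_vec S k l)"
    proof -
      have "Rm S l ** Rm S l ** Lam' S k ** Om' S k
           + 2 *\<^sub>R (Lam' S k ** Om' S k ** Lm S l ** Rm S l)
           - (Rm' S l ** Lam' S k ** Rm' S k) ** (Rm' S l ** Lam' S k ** Rm' S k)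
        = diag_mat (\<chi> m. of_real (?q m))"
        unfolding Rm_def Lm_def Rm'_diag Om'_diag Lam'_diag diag_mat_mult diag_mat_add diag_mat_diff diag_mat_scaleR
        by (rule arg_cong[where f=diag_mat]) (simp add: vec_eq_iff power2_eq_square scaleR_complex field_simps)
      then show ?thesis by (simp add: algebra_simps)
    qed
    have b: "(w_lmmse k m)\<^sup>2 * ((coef S k l)\<^sup>2 * ((beta S m l)\<^sup>2 + 2 * (hbar S m l)\<^sup>2 * beta S m l - (beta' S m l)\<^sup>2))
        = ?c * ?q m" for m
      using l by (simp add: coef_square power_divide power_mult_distrib)
    have c: "(sqrt (pilot_pow S k) * sqrt (pilot_pow S l) * real (tau_p S))\<^sup>2 = ?c"
      by (simp add: power_mult_distrib del: real_sqrt_mult)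
    have d: "diag_mat (\<chi> m. of_real (?c * ?q m)) = ?c *\<^sub>R diag_mat (\<chi> m. complex_of_real (?q m))"
      unfolding diag_mat_scaleR by (simp add: scaleR_complex)
    show ?thesis
      unfolding a b gain_lmmse[OF l] houter_scaleR c d scaleR_add_right[symmetric] scaleR_scaleR
      by (simp only: mult.assoc)
  qed
  have 3: "(pilot_pow S k * real (tau_p S) * sigma2 S) *\<^sub>R Om' S k
    = diag_mat (\<chi> m. of_real ((w_lmmse k m)\<^sup>2 * (sigma2 S * (real (tau_p S) * lambda' S m k))))"
    by (simp add: Om'_diag diag_mat_scaleR scaleR_complex ac_simps
      power_divide power_mult_distrib power2_eq_square[of "lambda' _ _ _"] flip: of_real_mult of_real_power of_real_divide)
  show ?thesis
    unfolding Gam_scaled_expand Gam_lmmse_def 1 3 b_lmmse_gain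
    by (simp only: 2 cong: sum.cong)
qed

section \<open>Trace expressions as Hermitian forms\<close>

lemma trace_hadj_mult_b_ls: "trace (hadj (diag_mat a) ** Rm' S l) = hdot a (b_ls S l)"
  by (simp add: Rm'_diag hadj_diag_mat diag_mat_mult trace_diag_mat b_ls_eq hdot_def)

text \<open>\<open>Rm'\<close> has real entries, so dropping the adjoint only conjugates the trace
  and keeps its modulus.\<close>

lemma cmod_trace_mult_Rm': "cmod (trace (diag_mat a ** Rm' S l)) = cmod (hdot a (b_ls S l))"
proof -
  have "trace (diag_mat a ** Rm' S l) = cnj (hdot a (b_ls S l))"
    by (simp add: Rm'_diag diag_mat_mult trace_diag_mat b_ls_eq hdot_def)
  then show ?thesis by simp
qed

lemma T_ls1_form: "T_ls1 S k l a = hdot a (Gam_ls1 S k l *v a)"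
proof -
  have "trace (hadj (diag_mat a) ** matrix_inv (Lam' S k) ** Rm' S l ** diag_mat a)
    = hdot a ((matrix_inv (Lam' S k) ** Rm' S l) *v a)"
  proof -
    have "hadj (diag_mat a) ** matrix_inv (Lam' S k) ** Rm' S l ** diag_mat a
      = hadj (diag_mat a) ** (matrix_inv (Lam' S k) ** Rm' S l) ** diag_mat a"
      by (simp only: matrix_mul_assoc)
    then show ?thesis
      by (simp only: inv_Lam'_diag Rm'_diag diag_mat_mult[of "\<chi> m. _ m" "\<chi> m. _ m"] trace_hadj_diag_mat)
  qed
  then show ?thesis
    by (simp add: T_ls1_def Gam_ls1_def hdot_form_scaleR)
qed

lemma T_ls2_form: "T_ls2 S k l a = hdot a (Gam_ls2 S k l *v a)"
proof -
  have 1: "Rm S l ** Rm S l + 2 *\<^sub>R (Lm S l ** Rm S l)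
      = diag_mat (\<chi> m. of_real ((beta S m l)\<^sup>2 + 2 * (hbar S m l)\<^sup>2 * beta S m l))"
    by (simp add: Rm_def Lm_def diag_mat_mult diag_mat_add diag_mat_scaleR power2_eq_square scaleR_complex mult.assoc)
  have 2: "Rm' S l ** Rm' S l = diag_mat (\<chi> m. of_real ((beta' S m l)\<^sup>2))"
    by (simp add: Rm'_diag diag_mat_mult power2_eq_square)
  show ?thesis
    unfolding T_ls2_def Gam_ls2_def 1 2 trace_hadj_mult_b_ls trace_hadj_diag_mat cmod_hdot_square
      hdot_form_scaleR hdot_form_diff hdot_form_add hdot_form_houter ..
qed

text \<open>Once \<open>Gam_ls\<close> is known to be positive definite, this makes the complex
  \<open>den_ls\<close> real and, for nonzero \<open>a\<close>, nonzero.\<close>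

lemma den_ls_form: "den_ls S k a = hdot a (Gam_ls S k *v a)"
proof -
  have "trace (hadj (diag_mat a) ** matrix_inv (Lam' S k) ** diag_mat a) = hdot a (matrix_inv (Lam' S k) *v a)"
    unfolding inv_Lam'_diag by (rule trace_hadj_diag_mat)
  then show ?thesis
    unfolding den_ls_def Gam_ls_def T_ls1_form T_ls2_form cmod_trace_mult_Rm' of_real_mult cmod_hdot_square
      hdot_form_scaleR hdot_form_diff hdot_form_add hdot_form_houter hdot_form_sum by simp
qed

end

theorem theorem3:
  fixes S :: "('w, 'm::finite, 'k::finite, 't::finite) cf_system"
    and k :: 'k
  assumes "cell_free S"
  shows
    "(\<forall>a. a \<noteq> 0 \<longrightarrow>
        complex_of_real (sinr_ul S (est_ls S k) k a) = gamma_ls S k a \<and>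
        SE_ul S (est_ls S k) k a = rate S (Re (gamma_ls S k a)) \<and>
        den_ls S k a \<noteq> 0 \<and>
        hdot a (Gam_ls S k *v a) \<noteq> 0 \<and>
        gamma_ls S k a =
          complex_of_real (data_pow S k) * hdot a (houter (b_ls S k) (b_ls S k) *v a)
          / hdot a (Gam_ls S k *v a)) \<and>
     invertible (Gam_ls S k) \<and>
     matrix_inv (Gam_ls S k) *v b_ls S k \<noteq> 0 \<and>
     (\<forall>a. a \<noteq> 0 \<longrightarrow>
        SE_ul S (est_ls S k) k a
        \<le> SE_ul S (est_ls S k) k (matrix_inv (Gam_ls S k) *v b_ls S k)) \<and>
     hdot (b_ls S k) (matrix_inv (Gam_ls S k) *v b_ls S k) \<in> \<real> \<and>
     SE_ul S (est_ls S k) k (matrix_inv (Gam_ls S k) *v b_ls S k) =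
       rate S (data_pow S k * Re (hdot (b_ls S k) (matrix_inv (Gam_ls S k) *v b_ls S k))) \<and>
     invertible (Gam_lmmse S k) \<and>
     matrix_inv (Gam_lmmse S k) *v b_lmmse S k \<noteq> 0 \<and>
     (\<forall>a. a \<noteq> 0 \<longrightarrow>
        SE_ul S (est_lmmse S k) k a
        \<le> SE_ul S (est_lmmse S k) k (matrix_inv (Gam_lmmse S k) *v b_lmmse S k)) \<and>
     hdot (b_lmmse S k) (matrix_inv (Gam_lmmse S k) *v b_lmmse S k) \<in> \<real> \<and>
     SE_ul S (est_lmmse S k) k (matrix_inv (Gam_lmmse S k) *v b_lmmse S k) =
       rate S (data_pow S k *
         Re (hdot (b_lmmse S k) (matrix_inv (Gam_lmmse S k) *v b_lmmse S k))) \<and>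
     SE_ul S (est_ls S k) k (matrix_inv (Gam_ls S k) *v b_ls S k) =
       SE_ul S (est_lmmse S k) k (matrix_inv (Gam_lmmse S k) *v b_lmmse S k)"
proof -
  interpret cell_free S by (rule assms)
  interpret LS: hermitian_pd "Gam_ls S k"
    unfolding Gam_ls_scaled by (rule Gam_scaled_pd[OF w_ls_nz])
  interpret LM: hermitian_pd "Gam_lmmse S k"
    unfolding Gam_lmmse_scaled by (rule Gam_scaled_pd[OF w_lmmse_nz])
  have b: "b_ls S k \<noteq> 0" "b_lmmse S k \<noteq> 0"
    unfolding b_ls_gain b_lmmse_gain
    by (rule gain_self_nonzero[OF w_ls_nz], rule gain_self_nonzero[OF w_lmmse_nz])
  have ls_eq: "SE_ul S (est_ls S k) k (matrix_inv (Gam_ls S k) *v b_ls S k) =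
       rate S (data_pow S k * Re (hdot (b_ls S k) (matrix_inv (Gam_ls S k) *v b_ls S k)))"
    unfolding est_ls_scaled Gam_ls_scaled b_ls_gain by (rule SE_scaled_obs_eq[OF w_ls_nz])
  have ls_le: "SE_ul S (est_ls S k) k a \<le> SE_ul S (est_ls S k) k (matrix_inv (Gam_ls S k) *v b_ls S k)" for a
    unfolding ls_eq unfolding est_ls_scaled Gam_ls_scaled b_ls_gain by (rule SE_scaled_obs_le[OF w_ls_nz])
  have lm_eq: "SE_ul S (est_lmmse S k) k (matrix_inv (Gam_lmmse S k) *v b_lmmse S k) =
       rate S (data_pow S k * Re (hdot (b_lmmse S k) (matrix_inv (Gam_lmmse S k) *v b_lmmse S k)))"
    unfolding est_lmmse_scaled Gam_lmmse_scaled b_lmmse_gain by (rule SE_scaled_obs_eq[OF w_lmmse_nz])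
  have lm_le: "SE_ul S (est_lmmse S k) k a
      \<le> SE_ul S (est_lmmse S k) k (matrix_inv (Gam_lmmse S k) *v b_lmmse S k)" for a
    unfolding lm_eq unfolding est_lmmse_scaled Gam_lmmse_scaled b_lmmse_gain
    by (rule SE_scaled_obs_le[OF w_lmmse_nz])
  \<comment> \<open>Both sides equal the optimal value for unit weights.\<close>
  have same: "hdot (b_ls S k) (matrix_inv (Gam_ls S k) *v b_ls S k)
      = hdot (b_lmmse S k) (matrix_inv (Gam_lmmse S k) *v b_lmmse S k)"
    unfolding Gam_ls_scaled b_ls_gain Gam_lmmse_scaled b_lmmse_gain
      optimal_value_scale_invariant[OF w_ls_nz] optimal_value_scale_invariant[OF w_lmmse_nz] ..
  have gam: "complex_of_real (sinr_ul S (est_ls S k) k a) = gamma_ls S k a"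
    and gam': "gamma_ls S k a = complex_of_real (data_pow S k) * hdot a (houter (b_ls S k) (b_ls S k) *v a)
          / hdot a (Gam_ls S k *v a)" for a
  proof -
    have "sinr_ul S (est_ls S k) k a
        = data_pow S k * ((cmod (hdot a (b_ls S k)))\<^sup>2 / Re (hdot a (Gam_ls S k *v a)))"
      unfolding est_ls_scaled b_ls_gain Gam_ls_scaled by (rule sinr_scaled_obs)
    then have "complex_of_real (sinr_ul S (est_ls S k) k a)
        = of_real (data_pow S k * (cmod (hdot a (b_ls S k)))\<^sup>2) / of_real (Re (hdot a (Gam_ls S k *v a)))"
      by simp
    \<comment> \<open>The form is real, so dividing by its embedded real part is dividing by the
      form itself.\<close>
    then show "complex_of_real (sinr_ul S (est_ls S k) k a) = gamma_ls S k a"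
      unfolding LS.form_real[symmetric] gamma_ls_def den_ls_form cmod_trace_mult_Rm' .
    show "gamma_ls S k a = complex_of_real (data_pow S k) * hdot a (houter (b_ls S k) (b_ls S k) *v a)
          / hdot a (Gam_ls S k *v a)"
      unfolding gamma_ls_def den_ls_form cmod_trace_mult_Rm' of_real_mult cmod_hdot_square hdot_form_houter ..
  qed
  have se: "SE_ul S (est_ls S k) k a = rate S (Re (gamma_ls S k a))" for a
    unfolding SE_ul_def gam[symmetric] Re_complex_of_real ..
  have nz: "hdot a (Gam_ls S k *v a) \<noteq> 0" if "a \<noteq> 0" for a
    using LS.positive[OF that] by auto
  show ?thesis
    using gam gam' se nz LS.invertible LM.invertible LS.inv_nonzero[OF b(1)] LM.inv_nonzero[OF b(2)]
      ls_le lm_le ls_eq lm_eq LS.form_inv_real LM.form_inv_real same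
    by (simp add: den_ls_form)
qed

end
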